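(* Let $(X_t)_{t\ge0}$ be a rich Lévy-type process on $\mathbb{R}^d$ with symbol $q$ and characteristics $(b,Q,\nu)$. If $f\in C_0(\mathbb{R}^d)$ and $f|_{B(0,\delta)}=0$ for some $\delta>0$, then $$\lim_{t\to0}\frac1t\,\mathbb{E}^xf(X_t-x)=\int_{\mathbb{R}^d\setminus\{0\}}f(y)\,\nu(x,dy)\qquad\text{for all }x\in\mathbb{R}^d.$$
   Context: $C_0(\mathbb{R}^d)$ is the space of continuous functions $\mathbb{R}^d\to\mathbb{R}$ vanishing at infinity; $B(x,r)$ is the open ball of radius $r$ around $x$. A Lévy-type process (= Feller process) $(X_t)_{t\ge0}$ on $\mathbb{R}^d$ is a Markov process with càdlàg sample paths whose transition semigroup $f\mapsto \mathbb{E}^{\bullet}f(X_t)$ is a Feller semigroup on $C_0(\mathbb{R}^d)$. Its generator $(A,\mathcal{D}(A))$ has as domain the set of $f\in C_0(\mathbb{R}^d)$ for which $\frac1t(\mathbb{E}^xf(X_t)-f(x))$ converges as $t\to0$, uniformly in $x\in\mathbb{R}^d$, to a function in $C_0(\mathbb{R}^d)$, and $Af$ is this limit. The process is called rich if $C_c^\infty(\mathbb{R}^d)\subseteq\mathcal{D}(A)$. For a rich process, $Af(x)=-\int_{\mathbb{R}^d}e^{ix\cdot\xi}q(x,\xi)\widehat f(\xi)\,d\xi$ for $f\in C_c^\infty(\mathbb{R}^d)$, where $\widehat f(\xi)=(2\pi)^{-d}\int_{\mathbb{R}^d} e^{-ix\cdot\xi}f(x)\,dx$ and $q$ is the symbol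 $$q(x,\xi)=q(x,0)-ib(x)\cdot\xi+\tfrac12\xi\cdot Q(x)\xi+\int_{\mathbb{R}^d\setminus\{0\}}\left(1-e^{iy\cdot\xi}+iy\cdot\xi\,\mathbf{1}_{(0,1)}(|y|)\right)\nu(x,dy).$$ For each $x$, $(b(x),Q(x),\nu(x,dy))$ is a Lévy triplet: $b(x)\in\mathbb{R}^d$, $Q(x)\in\mathbb{R}^{d\times d}$ symmetric positive semidefinite, $\nu(x,\cdot)$ a measure on $\mathbb{R}^d\setminus\{0\}$ with $\int\min\{|y|^2,1\}\,\nu(x,dy)<\infty$. The family $(b,Q,\nu)$ is called the characteristics. Standing assumption: $q(x,0)=0$ for all $x$. *)

theory Defs
  imports "HOL-Probability.Probability"
begin

definition C_zero :: "('a::euclidean_space \<Rightarrow> real) set" where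
  "C_zero = {f. continuous_on UNIV f \<and> (f \<longlongrightarrow> 0) at_infinity}"

text \<open>Iterated directional derivatives: \<open>C_k k f\<close> is \<open>k\<close>-fold continuous differentiability.\<close>

fun C_k :: "nat \<Rightarrow> ('a::euclidean_space \<Rightarrow> real) \<Rightarrow> bool" where
  "C_k 0 f \<longleftrightarrow> continuous_on UNIV f"
| "C_k (Suc k) f \<longleftrightarrow>
     (\<forall>x. f differentiable at x) \<and> (\<forall>v. C_k k (\<lambda>x. frechet_derivative f (at x) v))"

definition C_c_infinity :: "('a::euclidean_space \<Rightarrow> real) set" where
  "C_c_infinity = {f. (\<forall>k. C_k k f) \<and> compact (closure {x. f x \<noteq> 0})}"

definition feller_semigroup ::
    "(real \<Rightarrow> ('a::euclidean_space \<Rightarrow> real) \<Rightarrow> 'a \<Rightarrow> real) \<Rightarrow> bool" where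
  "feller_semigroup T \<longleftrightarrow>
     (\<forall>t\<ge>0. \<forall>f\<in>C_zero. T t f \<in> C_zero) \<and>
     (\<forall>t\<ge>0. \<forall>f\<in>C_zero. \<forall>g\<in>C_zero. \<forall>a b.
        T t (\<lambda>x. a * f x + b * g x) = (\<lambda>x. a * T t f x + b * T t g x)) \<and>
     (\<forall>f\<in>C_zero. T 0 f = f) \<and>
     (\<forall>s\<ge>0. \<forall>t\<ge>0. \<forall>f\<in>C_zero. T (s + t) f = T s (T t f)) \<and>
     (\<forall>t\<ge>0. \<forall>f\<in>C_zero. (\<forall>x. 0 \<le> f x \<and> f x \<le> 1) \<longrightarrow> (\<forall>x. 0 \<le> T t f x \<and> T t f x \<le> 1)) \<and>
     (\<forall>f\<in>C_zero. uniform_limit UNIV (\<lambda>t. T t f) f (at_right 0))"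

definition gen_domain ::
    "(real \<Rightarrow> ('a::euclidean_space \<Rightarrow> real) \<Rightarrow> 'a \<Rightarrow> real) \<Rightarrow> ('a \<Rightarrow> real) set" where
  "gen_domain T = {f \<in> C_zero. \<exists>g\<in>C_zero.
     uniform_limit UNIV (\<lambda>t x. (T t f x - f x) / t) g (at_right 0)}"

text \<open>The limit is unique; \<open>generator\<close> is only meaningful on \<open>gen_domain\<close>.\<close>

definition generator ::
    "(real \<Rightarrow> ('a::euclidean_space \<Rightarrow> real) \<Rightarrow> 'a \<Rightarrow> real) \<Rightarrow> ('a \<Rightarrow> real) \<Rightarrow> 'a \<Rightarrow> real" where
  "generator T f = (THE g. g \<in> C_zero \<and>
     uniform_limit UNIV (\<lambda>t x. (T t f x - f x) / t) g (at_right 0))"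

definition natural_filtration :: "'w measure \<Rightarrow> (real \<Rightarrow> 'w \<Rightarrow> 'a::euclidean_space) \<Rightarrow> real \<Rightarrow> 'w measure" where
  "natural_filtration M X s =
     sigma (space M) {X u -` B \<inter> space M | u B. 0 \<le> u \<and> u \<le> s \<and> B \<in> sets borel}"

text \<open>A process is a family of probability measures \<open>P x\<close> (the law of the process started
  at \<open>x\<close>) on one measurable space together with random variables \<open>X t\<close>; only times \<open>t \<ge> 0\<close> matter.
  The paths have infinite lifetime, i.e. the transition kernels are conservative.\<close>

definition markov_process ::
    "('a::euclidean_space \<Rightarrow> 'w measure) \<Rightarrow> (real \<Rightarrow> 'w \<Rightarrow> 'a) \<Rightarrow> bool" where
  "markov_process P X \<longleftrightarrow>
     (\<forall>x. prob_space (P x)) \<and>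
     (\<forall>x y. sets (P x) = sets (P y)) \<and>
     (\<forall>x. \<forall>t\<ge>0. X t \<in> borel_measurable (P x)) \<and>
     (\<forall>x. AE w in P x. X 0 w = x) \<and>
     (\<forall>t\<ge>0. \<forall>B\<in>sets borel.
        (\<lambda>x. measure (P x) {w \<in> space (P x). X t w \<in> B}) \<in> borel_measurable borel) \<and>
     (\<forall>x. \<forall>s\<ge>0. \<forall>t\<ge>0. \<forall>B\<in>sets borel. AE w in P x.
        real_cond_exp (P x) (natural_filtration (P x) X s) (\<lambda>w'. indicator B (X (s + t) w')) w
          = measure (P (X s w)) {w' \<in> space (P (X s w)). X t w' \<in> B})"

definition cadlag :: "(real \<Rightarrow> 'a::topological_space) \<Rightarrow> bool" where
  "cadlag p \<longleftrightarrow> (\<forall>t\<ge>0. continuous (at_right t) p) \<and> (\<forall>t>0. \<exists>l. (p \<longlongrightarrow> l) (at_left t))"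

definition transition_semigroup ::
    "('a::euclidean_space \<Rightarrow> 'w measure) \<Rightarrow> (real \<Rightarrow> 'w \<Rightarrow> 'a) \<Rightarrow> real \<Rightarrow> ('a \<Rightarrow> real) \<Rightarrow> 'a \<Rightarrow> real" where
  "transition_semigroup P X t f x = (\<integral>w. f (X t w) \<partial>P x)"

definition levy_type_process ::
    "('a::euclidean_space \<Rightarrow> 'w measure) \<Rightarrow> (real \<Rightarrow> 'w \<Rightarrow> 'a) \<Rightarrow> bool" where
  "levy_type_process P X \<longleftrightarrow>
     markov_process P X \<and>
     (\<forall>x. \<forall>w\<in>space (P x). cadlag (\<lambda>t. X t w)) \<and>
     feller_semigroup (transition_semigroup P X)"

definition rich ::
    "('a::euclidean_space \<Rightarrow> 'w measure) \<Rightarrow> (real \<Rightarrow> 'w \<Rightarrow> 'a) \<Rightarrow> bool" where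
  "rich P X \<longleftrightarrow> C_c_infinity \<subseteq> gen_domain (transition_semigroup P X)"

definition fourier :: "(real ^ 'n \<Rightarrow> real) \<Rightarrow> real ^ 'n \<Rightarrow> complex" where
  "fourier f \<xi> = 1 / (2 * pi) ^ CARD('n) * (\<integral>x. exp (- \<i> * of_real (x \<bullet> \<xi>)) * of_real (f x) \<partial>lborel)"

text \<open>The Levy measure lives on the subspace of nonzero vectors, so plain integrals with respect
  to it are integrals over the complement of the origin.\<close>

definition levy_triplet :: "real ^ 'n \<Rightarrow> real ^ 'n ^ 'n \<Rightarrow> (real ^ 'n) measure \<Rightarrow> bool" where
  "levy_triplet b Q N \<longleftrightarrow>
     transpose Q = Q \<and> (\<forall>v. 0 \<le> v \<bullet> (Q *v v)) \<and>
     sets N = sets (restrict_space borel (- {0})) \<and>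
     (\<integral>\<^sup>+y. ennreal (min ((norm y)\<^sup>2) 1) \<partial>N) < \<infinity>"

definition characteristics ::
    "(real ^ 'n \<Rightarrow> real ^ 'n \<Rightarrow> complex) \<Rightarrow> (real ^ 'n \<Rightarrow> real ^ 'n) \<Rightarrow> (real ^ 'n \<Rightarrow> real ^ 'n ^ 'n)
      \<Rightarrow> (real ^ 'n \<Rightarrow> (real ^ 'n) measure) \<Rightarrow> bool" where
  "characteristics q b Q \<nu> \<longleftrightarrow> (\<forall>x.
     levy_triplet (b x) (Q x) (\<nu> x) \<and>
     (\<forall>\<xi>. q x \<xi> = q x 0 - \<i> * of_real (b x \<bullet> \<xi>) + 1 / 2 * of_real (\<xi> \<bullet> (Q x *v \<xi>))
        + (\<integral>y. 1 - exp (\<i> * of_real (y \<bullet> \<xi>))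
             + \<i> * of_real (y \<bullet> \<xi>) * indicator {0<..<1} (norm y) \<partial>\<nu> x)))"

definition symbol ::
    "(real ^ 'n \<Rightarrow> 'w measure) \<Rightarrow> (real \<Rightarrow> 'w \<Rightarrow> real ^ 'n) \<Rightarrow> (real ^ 'n \<Rightarrow> real ^ 'n \<Rightarrow> complex) \<Rightarrow> bool" where
  "symbol P X q \<longleftrightarrow> (\<forall>f\<in>C_c_infinity. \<forall>x.
     of_real (generator (transition_semigroup P X) f x)
       = - (\<integral>\<xi>. exp (\<i> * of_real (x \<bullet> \<xi>)) * q x \<xi> * fourier f \<xi> \<partial>lborel))"

end

theory Submission
  imports Defs
begin

text \<open>Fix \<open>x\<close>. For a smooth compactly supported \<open>w\<close> that vanishes near \<open>x\<close>, the limit of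
  \<open>E w (X t) / t\<close> is the generator at \<open>x\<close>; Fourier inversion and Fubini turn the symbol formula
  into the integral of \<open>w (x + y)\<close> against \<open>\<nu> x\<close>, the drift and diffusion terms dropping out because the
  derivatives of \<open>w\<close> at \<open>x\<close> vanish. Applying the generator to a bump function with its maximum at
  \<open>x\<close> shows that the probability of leaving a ball around \<open>x\<close> by time \<open>t\<close> is \<open>O(t)\<close>, so uniform
  approximation of \<open>f\<close> by such \<open>w\<close> suffices. We only need those \<open>w\<close> that are finite sums of
  products of one-dimensional test functions: they are dense by Stone-Weierstrass, and their Fourier
  inversion reduces to the real line.\<close>

section \<open>Smooth functions on the line\<close>

text \<open>Uniform closeness alone would be worthless: an error \<epsilon> divided by
  \<open>t\<close> blows up, and \<open>\<nu> x\<close> may have infinite mass near the origin. The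
  approximant therefore has to agree exactly with the shifted \<open>f\<close> on a ball around
  \<open>x\<close>. Then on both sides \<epsilon> is weighted only by what happens outside that
  ball: an exit probability of order \<open>t\<close>, and a tail mass of \<open>\<nu> x\<close>,
  which is finite. This is why polynomials are multiplied by a fixed weight that vanishes near
  \<open>x\<close>. Radii shrink by factors of the dimension because products of one-dimensional
  functions live on cubes, which are compared with balls through the l1 norm. On the Fourier side
  everything rests on the integrability of
  \<open>(1 + (norm \<xi>)\<^sup>2) * norm (G \<xi>)\<close>. This weight, times
  \<open>min ((norm y)\<^sup>2) 1\<close>, dominates the integrand of the symbol, as Fubini
  requires. It also allows the inversion formula to be differentiated twice under the integral,
  which removes drift and diffusion.\<close>

definition smooth :: "(real \<Rightarrow> real) \<Rightarrow> bool" where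
  "smooth u \<longleftrightarrow> (\<forall>k s. (deriv ^^ k) u differentiable at s)"

text \<open>By induction every iterated \<open>deriv\<close> stays in a class that is closed under
  differentiation. Smoothness proofs thus reduce to guessing such a class \<open>P\<close> around
  the given function.\<close>

lemma smooth_coinduct:
  assumes "P u"
    and "\<And>u. P u \<Longrightarrow> \<exists>u'. P u' \<and> (\<forall>s. (u has_real_derivative u' s) (at s))"
  shows "smooth u"
proof -
  have "P ((deriv ^^ k) u)" for k
  proof (induction k)
    case (Suc k)
    then obtain u' where "P u'" "\<forall>s. ((deriv ^^ k) u has_real_derivative u' s) (at s)"
      using assms(2) by blast
    then have "deriv ((deriv ^^ k) u) = u'" by (auto intro!: ext DERIV_imp_deriv)
    with \<open>P u'\<close> show ?case by simp
  qed (simp add: assms(1))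
  then show ?thesis
    unfolding smooth_def using assms(2) by (meson real_differentiable_def)
qed

lemma smooth_deriv: "smooth u \<Longrightarrow> smooth (deriv u)"
  unfolding smooth_def by (metis comp_apply funpow_Suc_right)

lemma smooth_DERIV: "smooth u \<Longrightarrow> (u has_real_derivative deriv u s) (at s)"
  unfolding smooth_def by (metis DERIV_deriv_iff_real_differentiable funpow_0)

lemma smooth_continuous_on: "smooth u \<Longrightarrow> continuous_on S u"
  by (meson DERIV_continuous_on has_field_derivative_at_within smooth_DERIV)

lemma smooth_affine: "smooth (\<lambda>s. a * s + b)"
proof (rule smooth_coinduct[where P = "\<lambda>u. \<exists>a b. u = (\<lambda>s. a * s + b)"])
  fix u :: "real \<Rightarrow> real" assume "\<exists>a b. u = (\<lambda>s. a * s + b)"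
  then obtain a b where u: "u = (\<lambda>s. a * s + b)" by blast
  show "\<exists>u'. (\<exists>a b. u' = (\<lambda>s. a * s + b)) \<and> (\<forall>s. (u has_real_derivative u' s) (at s))"
  proof (intro exI[of _ "\<lambda>s. 0 * s + a"] conjI)
    show "\<exists>a' b. (\<lambda>s. 0 * s + a) = (\<lambda>s. a' * s + b)" by (rule exI, rule exI, rule refl)
  qed (auto simp: u intro!: derivative_eq_intros)
qed (rule exI, rule exI, rule refl)

lemma smooth_add: assumes "smooth u" "smooth v" shows "smooth (\<lambda>s. u s + v s)"
proof (rule smooth_coinduct[where P = "\<lambda>w. \<exists>u v. smooth u \<and> smooth v \<and> w = (\<lambda>s. u s + v s)"])
  fix w assume "\<exists>u v. smooth u \<and> smooth v \<and> w = (\<lambda>s. u s + v s)"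
  then obtain u v where "smooth u" "smooth v" and w: "w = (\<lambda>s. u s + v s)" by blast
  then show "\<exists>w'. (\<exists>u v. smooth u \<and> smooth v \<and> w' = (\<lambda>s. u s + v s)) \<and>
      (\<forall>s. (w has_real_derivative w' s) (at s))"
    by (intro exI[of _ "\<lambda>s. deriv u s + deriv v s"])
      (auto intro: smooth_deriv derivative_intros smooth_DERIV)
qed (use assms in blast)

lemma smooth_affine_compose: assumes "smooth u" shows "smooth (\<lambda>s. u (a * s + b))"
\<comment> \<open>The factor \<open>c\<close> makes the class closed: each differentiation brings
  out another factor \<open>a\<close>.\<close>
proof (rule smooth_coinduct[where P = "\<lambda>w. \<exists>c u. smooth u \<and> w = (\<lambda>s. c * u (a * s + b))"])
  fix w assume "\<exists>c u. smooth u \<and> w = (\<lambda>s. c * u (a * s + b))"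
  then obtain c u where u: "smooth u" and w: "w = (\<lambda>s. c * u (a * s + b))" by blast
  show "\<exists>w'. (\<exists>c u. smooth u \<and> w' = (\<lambda>s. c * u (a * s + b))) \<and>
      (\<forall>s. (w has_real_derivative w' s) (at s))"
  proof (intro exI[of _ "\<lambda>s. (c * a) * deriv u (a * s + b)"] conjI allI)
    show "(w has_real_derivative c * a * deriv u (a * s + b)) (at s)" for s
      unfolding w by (rule derivative_eq_intros DERIV_chain2[OF smooth_DERIV[OF u]] refl)+ simp
  qed (use u smooth_deriv in blast)
qed (use assms in \<open>auto intro!: exI[of _ 1]\<close>)

text \<open>By Leibniz' rule, finite sums of products are closed under differentiation.\<close>

inductive smooth_product_sum :: "(real \<Rightarrow> real) \<Rightarrow> bool" where
  mult: "smooth u \<Longrightarrow> smooth v \<Longrightarrow> smooth_product_sum (\<lambda>s. u s * v s)"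
| add: "smooth_product_sum u \<Longrightarrow> smooth_product_sum v \<Longrightarrow> smooth_product_sum (\<lambda>s. u s + v s)"

lemma smooth_mult: assumes "smooth u" "smooth v" shows "smooth (\<lambda>s. u s * v s)"
proof (rule smooth_coinduct[where P = smooth_product_sum])
  show "smooth_product_sum (\<lambda>s. u s * v s)" using assms by (rule smooth_product_sum.mult)
  show "\<exists>w'. smooth_product_sum w' \<and> (\<forall>s. (w has_real_derivative w' s) (at s))"
    if "smooth_product_sum w" for w
    using that
  proof induction
    case (mult u v)
    have "((\<lambda>s. u s * v s) has_real_derivative deriv u s * v s + u s * deriv v s) (at s)" for s
      using mult by (auto intro!: derivative_eq_intros smooth_DERIV)
    moreover have "smooth_product_sum (\<lambda>s. deriv u s * v s + u s * deriv v s)"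
      using mult by (intro smooth_product_sum.intros smooth_deriv)
    ultimately show ?case by blast
  next
    case (add u v)
    then obtain u' v' where "smooth_product_sum u'" "smooth_product_sum v'"
      "\<forall>s. (u has_real_derivative u' s) (at s)" "\<forall>s. (v has_real_derivative v' s) (at s)"
      by blast
    then show ?case
      by (intro exI[of _ "\<lambda>s. u' s + v' s"]) (auto intro: smooth_product_sum.add derivative_intros)
  qed
qed

section \<open>A smooth function that is flat at the origin, and the bumps built from it\<close>

definition flat_exp :: "real \<Rightarrow> real" where
  "flat_exp s = (if 0 < s then exp (- 1 / s) else 0)"

lemma flat_exp_pos: "0 < s \<Longrightarrow> 0 < flat_exp s"
  and flat_exp_zero: "s \<le> 0 \<Longrightarrow> flat_exp s = 0"
  and flat_exp_nonneg: "0 \<le> flat_exp s"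
  and flat_exp_le_1: "flat_exp s \<le> 1"
  by (auto simp: flat_exp_def)

text \<open>With \<open>x = 1 / s\<close> this is the statement that exp(-1/s) beats every power of
  1/s as \<open>s\<close> decreases to 0.\<close>

lemma poly_times_exp_tendsto_0:
  fixes p :: "real poly"
  shows "((\<lambda>x. poly p x * exp (- x)) \<longlongrightarrow> 0) at_top"
proof -
  have "((\<lambda>x. \<Sum>i\<le>degree p. coeff p i * (x ^ i / exp x)) \<longlongrightarrow> (\<Sum>i\<le>degree p. coeff p i * 0)) at_top"
    by (intro tendsto_intros tendsto_power_div_exp_0)
  then show ?thesis
    by (simp add: poly_altdef sum_distrib_right exp_minus divide_inverse mult.assoc)
qed

text \<open>Every derivative is a polynomial in 1/s times exp(-1/s) on the positive axis and 0
  elsewhere. This class is closed under differentiation; only the origin needs a limit.\<close>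

lemma smooth_flat_exp: "smooth flat_exp"
proof (rule smooth_coinduct[where
      P = "\<lambda>u. \<exists>p. u = (\<lambda>s. if 0 < s then poly p (1 / s) * exp (- 1 / s) else 0)"])
  show "\<exists>p. flat_exp = (\<lambda>s. if 0 < s then poly p (1 / s) * exp (- 1 / s) else 0)"
    by (intro exI[of _ "[:1:]"]) (auto simp: flat_exp_def)
next
  fix u :: "real \<Rightarrow> real"
  assume "\<exists>p. u = (\<lambda>s. if 0 < s then poly p (1 / s) * exp (- 1 / s) else 0)"
  then obtain p where u: "u = (\<lambda>s. if 0 < s then poly p (1 / s) * exp (- 1 / s) else 0)" by blast
  \<comment> \<open>Product and chain rule give (1/s)^2 (p - p')(1/s) exp(-1/s), where p' denotes
    the derivative of the polynomial; \<open>[:0, 0, 1:]\<close> is the square of the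
    variable.\<close>
  define p' where "p' = [:0, 0, 1:] * (p - pderiv p)"
  define u' where "u' = (\<lambda>s. if 0 < s then poly p' (1 / s) * exp (- 1 / s) else 0)"
  have "(u has_real_derivative u' s) (at s)" for s
  proof (cases s "0 :: real" rule: linorder_cases)
    case less
    have "((\<lambda>s. 0) has_real_derivative 0) (at s)" by simp
    then have "(u has_real_derivative 0) (at s)"
      by (rule has_field_derivative_transform_within_open[of _ _ _ "{..<0}"]) (use less in \<open>auto simp: u\<close>)
    then show ?thesis using less by (simp add: u'_def)
  next
    case greater
    have "((\<lambda>s. poly p (1 / s) * exp (- 1 / s)) has_real_derivative u' s) (at s)"
      using greater
      by (auto intro!: derivative_eq_intros DERIV_chain2[OF poly_DERIV] simp: u'_def p'_def field_simps power2_eq_square)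
    then show ?thesis
      by (rule has_field_derivative_transform_within_open[of _ _ _ "{0<..}"]) (use greater in \<open>auto simp: u\<close>)
  next
    case equal
    \<comment> \<open>The difference quotient at 0 carries an extra factor 1/s, which
      \<open>pCons 0 p\<close> absorbs into the polynomial.\<close>
    have "((\<lambda>s. poly (pCons 0 p) (1 / s) * exp (- (1 / s))) \<longlongrightarrow> 0) (at_right 0)"
      by (rule filterlim_compose[OF poly_times_exp_tendsto_0])
        (use filterlim_inverse_at_top_right in \<open>simp add: inverse_eq_divide\<close>)
    then have "((\<lambda>h. (u (0 + h) - u 0) / h) \<longlongrightarrow> 0) (at_right 0)"
      by (rule Lim_transform_eventually) (auto simp: eventually_at_filter u field_simps)
    moreover have "((\<lambda>h. (u (0 + h) - u 0) / h) \<longlongrightarrow> 0) (at_left 0)"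
      by (rule Lim_transform_eventually[OF tendsto_const]) (auto simp: eventually_at_filter u)
    ultimately have "((\<lambda>h. (u (0 + h) - u 0) / h) \<longlongrightarrow> 0) (at 0)"
      by (simp add: filterlim_at_split)
    then show ?thesis by (simp add: equal u'_def DERIV_def)
  qed
  then show "\<exists>u'. (\<exists>p. u' = (\<lambda>s. if 0 < s then poly p (1 / s) * exp (- 1 / s) else 0)) \<and>
      (\<forall>s. (u has_real_derivative u' s) (at s))"
    by (auto simp: u'_def intro!: exI[of _ u'])
qed

definition test_fun :: "(real \<Rightarrow> real) \<Rightarrow> bool" where
  "test_fun u \<longleftrightarrow> smooth u \<and> (\<exists>R. \<forall>s. R < \<bar>s\<bar> \<longrightarrow> u s = 0)"

lemma test_fun_mult: "smooth u \<Longrightarrow> test_fun v \<Longrightarrow> test_fun (\<lambda>s. u s * v s)"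
  unfolding test_fun_def by (auto intro: smooth_mult)

lemma test_fun_deriv: assumes "test_fun u" shows "test_fun (deriv u)"
proof -
  obtain R where u: "smooth u" and R: "\<And>s. R < \<bar>s\<bar> \<Longrightarrow> u s = 0"
    using assms unfolding test_fun_def by blast
  have "deriv u s = 0" if "R < \<bar>s\<bar>" for s
  proof (rule DERIV_imp_deriv)
    have "open {s. R < \<bar>s\<bar>}" by (intro open_Collect_less continuous_intros)
    then show "(u has_real_derivative 0) (at s)"
      by (rule has_field_derivative_transform_within_open[OF DERIV_const]) (use that R in auto)
  qed
  then show ?thesis unfolding test_fun_def using smooth_deriv[OF u] by blast
qed

definition bump :: "real \<Rightarrow> real \<Rightarrow> real" where
  "bump r s = flat_exp (r - s) * flat_exp (r + s)"

lemma test_fun_bump: "test_fun (\<lambda>s. bump r (s - a))"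
proof -
  have "smooth (\<lambda>s. flat_exp (- 1 * s + (r + a)) * flat_exp (1 * s + (r - a)))"
    by (intro smooth_mult smooth_affine_compose smooth_flat_exp)
  moreover have "\<forall>s. \<bar>r\<bar> + \<bar>a\<bar> < \<bar>s\<bar> \<longrightarrow> bump r (s - a) = 0"
    by (auto simp: bump_def flat_exp_def)
  ultimately show ?thesis unfolding test_fun_def bump_def by (auto simp: algebra_simps)
qed

lemma bump_pos: "\<bar>s\<bar> < r \<Longrightarrow> 0 < bump r s"
  and bump_zero: "r \<le> \<bar>s\<bar> \<Longrightarrow> bump r s = 0"
  and bump_nonneg: "0 \<le> bump r s"
  and bump_le_1: "bump r s \<le> 1"
  by (auto simp: bump_def flat_exp_def abs_if mult_le_one split: if_splits)

text \<open>The exponent 1/(r-s) + 1/(r+s) = 2r/(r^2 - s^2) is smallest at s = 0. This gives the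
  bump around \<open>x\<close> its maximum at \<open>x\<close>.\<close>

lemma bump_le_bump_0: assumes "0 < r" shows "bump r s \<le> bump r 0"
proof (cases "\<bar>s\<bar> < r")
  case True
  have *: "0 < r - s" "0 < r + s" using True by auto
  have "1 / r + 1 / r = 2 * r / (r * r)" using assms by (simp add: field_simps)
  also have "\<dots> \<le> 2 * r / ((r - s) * (r + s))"
    using * assms by (intro divide_left_mono mult_pos_pos) (auto simp: algebra_simps)
  also have "\<dots> = 1 / (r - s) + 1 / (r + s)" using * by (simp add: field_simps)
  finally have "1 / r + 1 / r \<le> 1 / (r - s) + 1 / (r + s)" .
  then show ?thesis using True by (auto simp: bump_def flat_exp_def simp flip: exp_add)
qed (use bump_zero bump_nonneg in auto)

section \<open>Sums of tensor products of test functions\<close>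

text \<open>A scalar can be absorbed into one factor, so these two rules already describe a linear
  space.\<close>

inductive_set tensor_test :: "('a::euclidean_space \<Rightarrow> real) set" where
  prod: "(\<And>b. b \<in> Basis \<Longrightarrow> test_fun (u b)) \<Longrightarrow> (\<lambda>y. \<Prod>b\<in>Basis. u b (y \<bullet> b)) \<in> tensor_test"
| add: "g \<in> tensor_test \<Longrightarrow> h \<in> tensor_test \<Longrightarrow> (\<lambda>y. g y + h y) \<in> tensor_test"

lemma tensor_test_sum:
  assumes "finite I" "I \<noteq> {}" "\<And>i. i \<in> I \<Longrightarrow> g i \<in> tensor_test"
  shows "(\<lambda>y. \<Sum>i\<in>I. g i y) \<in> tensor_test"
  using assms
proof (induction I rule: finite_ne_induct)
  case (insert i I)
  then have "(\<lambda>y. g i y + (\<Sum>j\<in>I. g j y)) \<in> tensor_test" by (intro tensor_test.add) auto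
  with insert show ?case by simp
qed auto

text \<open>The new factor merges with the \<open>j\<close>-th factor of each product. Smoothness of
  \<open>v\<close> is enough, since the old factor supplies the compact support.\<close>

lemma tensor_test_mult_component:
  assumes "g \<in> tensor_test" "smooth v" "j \<in> Basis"
  shows "(\<lambda>y. v (y \<bullet> j) * g y) \<in> tensor_test"
  using assms(1)
proof induction
  case (prod u)
  define w where "w = u(j := (\<lambda>s. v s * u j s))"
  have "(\<lambda>y. \<Prod>b\<in>Basis. w b (y \<bullet> b)) \<in> tensor_test"
    using prod assms by (intro tensor_test.prod) (auto simp: w_def intro: test_fun_mult)
  moreover have "(\<Prod>b\<in>Basis. w b (y \<bullet> b)) = v (y \<bullet> j) * (\<Prod>b\<in>Basis. u b (y \<bullet> b))" for y
    using assms(3) by (simp add: prod.remove[of Basis j] w_def)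
  ultimately show ?case by simp
next
  case (add g h)
  from tensor_test.add[OF add.IH] show ?case by (simp only: distrib_left)
qed

lemma tensor_test_scale: "g \<in> tensor_test \<Longrightarrow> (\<lambda>y. c * g y) \<in> tensor_test"
  using tensor_test_mult_component[OF _ smooth_affine[of 0 c] SOME_Basis] by simp

text \<open>This connects the class with Stone-Weierstrass: a polynomial has no compact support, but
  its product with a fixed member of the class does. A linear functional is expanded in coordinates,
  and each coordinate is a one-variable factor.\<close>

lemma tensor_test_mult_real_polynomial_function:
  fixes g :: "'a::euclidean_space \<Rightarrow> real"
  assumes "real_polynomial_function p" "g \<in> tensor_test"
  shows "(\<lambda>y. p y * g y) \<in> tensor_test"
  using assms
proof (induction arbitrary: g)
  case (linear f)
  have "f y * g y = (\<Sum>b\<in>Basis. (f b * (y \<bullet> b) + 0) * g y)" for y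
  proof -
    have "f y = f (\<Sum>b\<in>Basis. (y \<bullet> b) *\<^sub>R b)" by (simp add: euclidean_representation)
    also have "\<dots> = (\<Sum>b\<in>Basis. (y \<bullet> b) * f b)"
      using linear(1) by (simp add: bounded_linear.linear linear_sum linear_scale)
    finally show ?thesis by (simp add: sum_distrib_left mult_ac)
  qed
  moreover have "(\<lambda>y. \<Sum>b\<in>Basis. (f b * (y \<bullet> b) + 0) * g y) \<in> tensor_test"
    using linear(2) by (intro tensor_test_sum tensor_test_mult_component[of g "\<lambda>s. f _ * s + 0"] smooth_affine) auto
  ultimately show ?case by (simp only:)
next
  case (const c)
  then show ?case by (rule tensor_test_scale)
next
  case (add f1 f2)
  from tensor_test.add[OF add.IH(1)[OF add.prems] add.IH(2)[OF add.prems]] show ?case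
    by (simp only: distrib_right)
next
  case (mult f1 f2)
  from mult.IH(1)[OF mult.IH(2)[OF mult.prems]] show ?case by (simp only: mult.assoc)
qed

lemma tensor_test_support:
  assumes "g \<in> tensor_test" obtains R where "\<And>y. R < norm y \<Longrightarrow> g y = 0"
proof -
  have "\<exists>R. \<forall>y. R < norm y \<longrightarrow> g y = 0"
    using assms
  proof induction
    case (prod u)
    then have "\<forall>b\<in>Basis. \<exists>R. \<forall>s. R < \<bar>s\<bar> \<longrightarrow> u b s = 0" by (auto simp: test_fun_def)
    then obtain R where R: "\<And>b s. b \<in> Basis \<Longrightarrow> R b < \<bar>s\<bar> \<Longrightarrow> u b s = 0" by metis
    \<comment> \<open>The sum of the one-dimensional radii serves as radius: the norm is at most the
      l1 norm, so beyond this sum some coordinate exceeds its own radius.\<close>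
    have "(\<Prod>b\<in>Basis. u b (y \<bullet> b)) = 0" if "(\<Sum>b\<in>Basis. R b) < norm y" for y
    proof -
      have "(\<Sum>b\<in>Basis. R b) < (\<Sum>b\<in>Basis. \<bar>y \<bullet> b\<bar>)" using that norm_le_l1[of y] by linarith
      then obtain b where "b \<in> Basis" "R b < \<bar>y \<bullet> b\<bar>" by (meson leD leI sum_mono)
      with R show ?thesis by (auto intro!: prod_zero)
    qed
    then show ?case by blast
  next
    case (add g h)
    then obtain R S where "\<forall>y. R < norm y \<longrightarrow> g y = 0" "\<forall>y. S < norm y \<longrightarrow> h y = 0" by blast
    then show ?case by (intro exI[of _ "max R S"]) auto
  qed
  then show ?thesis using that by blast
qed

text \<open>By the product rule a directional derivative is a combination of products in which one
  factor is replaced by its derivative. Being closed under directional derivatives is what the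
  recursion in \<open>C_k\<close> asks for.\<close>

lemma tensor_test_has_derivative:
  fixes g :: "'a::euclidean_space \<Rightarrow> real"
  assumes "g \<in> tensor_test"
  shows "\<exists>D. (\<forall>v. (\<lambda>x. D x v) \<in> tensor_test) \<and> (\<forall>x. (g has_derivative D x) (at x))"
  using assms
proof induction
  case (prod u)
  define D :: "'a \<Rightarrow> 'a \<Rightarrow> real" where
    "D x v = (\<Sum>i\<in>Basis. (v \<bullet> i) * deriv (u i) (x \<bullet> i) * (\<Prod>j\<in>Basis - {i}. u j (x \<bullet> j)))" for x v
  have "((\<lambda>y. u b (y \<bullet> b)) has_derivative (\<lambda>v. (v \<bullet> b) * deriv (u b) (x \<bullet> b))) (at x)"
    if "b \<in> Basis" for b x
  proof -
    have "(u b has_derivative (\<lambda>s. s * deriv (u b) (x \<bullet> b))) (at (x \<bullet> b))"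
      using smooth_DERIV[of "u b" "x \<bullet> b"] prod[OF that]
      by (simp add: test_fun_def has_field_derivative_def mult_commute_abs)
    from has_derivative_compose[OF has_derivative_inner_left[OF has_derivative_ident] this]
    show ?thesis .
  qed
  then have "((\<lambda>y. \<Prod>b\<in>Basis. u b (y \<bullet> b)) has_derivative D x) (at x)" for x
    unfolding D_def by (rule has_derivative_prod)
  moreover have "(\<lambda>x. D x v) \<in> tensor_test" for v
  proof -
    have "(\<lambda>x. (v \<bullet> i) * (\<Prod>j\<in>Basis. (u(i := deriv (u i))) j (x \<bullet> j))) \<in> tensor_test"
      if "i \<in> Basis" for i
      using prod that by (intro tensor_test_scale tensor_test.prod) (auto intro: test_fun_deriv)
    then have "(\<lambda>x. \<Sum>i\<in>Basis. (v \<bullet> i) * (\<Prod>j\<in>Basis. (u(i := deriv (u i))) j (x \<bullet> j))) \<in> tensor_test"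
      by (intro tensor_test_sum) auto
    moreover have "D x v = (\<Sum>i\<in>Basis. (v \<bullet> i) * (\<Prod>j\<in>Basis. (u(i := deriv (u i))) j (x \<bullet> j)))" for x
      unfolding D_def
    proof (rule sum.cong[OF refl])
      fix i :: 'a assume i: "i \<in> Basis"
      show "(v \<bullet> i) * deriv (u i) (x \<bullet> i) * (\<Prod>j\<in>Basis - {i}. u j (x \<bullet> j)) =
          (v \<bullet> i) * (\<Prod>j\<in>Basis. (u(i := deriv (u i))) j (x \<bullet> j))"
        by (subst prod.remove[OF finite_Basis i]) simp
    qed
    ultimately show ?thesis by (simp only:)
  qed
  ultimately show ?case by blast
next
  case (add g h)
  then obtain D E where "\<forall>v. (\<lambda>x. D x v) \<in> tensor_test" "\<forall>x. (g has_derivative D x) (at x)"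
    "\<forall>v. (\<lambda>x. E x v) \<in> tensor_test" "\<forall>x. (h has_derivative E x) (at x)" by blast
  then show ?case
    by (intro exI[of _ "\<lambda>x v. D x v + E x v"]) (auto intro: tensor_test.add derivative_intros)
qed

lemma tensor_test_continuous_on: "g \<in> tensor_test \<Longrightarrow> continuous_on S g"
  by (meson continuous_at_imp_continuous_on has_derivative_continuous tensor_test_has_derivative)

lemma tensor_test_C_k: "g \<in> tensor_test \<Longrightarrow> C_k k g"
proof (induction k arbitrary: g)
  case 0
  then show ?case by (simp add: tensor_test_continuous_on)
next
  case (Suc k)
  obtain D where D: "\<And>v. (\<lambda>x. D x v) \<in> tensor_test" "\<And>x. (g has_derivative D x) (at x)"
    using tensor_test_has_derivative[OF Suc.prems] by blast
  then have "frechet_derivative g (at x) = D x" for x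
    by (metis frechet_derivative_at)
  with D Suc.IH show ?case by (auto simp: differentiable_def)
qed

lemma tensor_test_subset_C_c_infinity: "tensor_test \<subseteq> C_c_infinity"
proof
  fix g :: "'a \<Rightarrow> real" assume g: "g \<in> tensor_test"
  obtain R where "\<And>y. R < norm y \<Longrightarrow> g y = 0" using tensor_test_support[OF g] by blast
  then have "{x. g x \<noteq> 0} \<subseteq> cball 0 R" by (auto simp: not_less[symmetric])
  then have "compact (closure {x. g x \<noteq> 0})"
    by (meson bounded_cball bounded_closure bounded_subset closed_closure compact_eq_bounded_closed)
  then show "g \<in> C_c_infinity" using g by (simp add: C_c_infinity_def tensor_test_C_k)
qed

section \<open>Fourier inversion on the line\<close>

text \<open>A majorant that splits as \<open>g x * h y\<close> makes the integrand integrable on the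
  product space. Both exchanges of integrals below have such a majorant. Sigma-finiteness enters as
  a plain assumption because for a Levy measure it has to be derived first.\<close>

lemma Fubini_dominated:
  fixes f :: "'a \<Rightarrow> 'b \<Rightarrow> 'c::{banach, second_countable_topology}"
  assumes "sigma_finite_measure M1" "sigma_finite_measure M2"
    and [measurable]: "case_prod f \<in> borel_measurable (M1 \<Otimes>\<^sub>M M2)"
    and g: "integrable M1 g" and h: "integrable M2 h"
    and le: "\<And>x y. x \<in> space M1 \<Longrightarrow> y \<in> space M2 \<Longrightarrow> norm (f x y) \<le> g x * h y"
  shows "integrable M1 (\<lambda>x. \<integral>y. f x y \<partial>M2)"
    and "(\<integral>x. (\<integral>y. f x y \<partial>M2) \<partial>M1) = (\<integral>y. (\<integral>x. f x y \<partial>M1) \<partial>M2)"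
proof -
  interpret pair_sigma_finite M1 M2 using assms(1,2) by (rule pair_sigma_finite.intro)
  have [measurable]: "g \<in> borel_measurable M1" "h \<in> borel_measurable M2" using g h by auto
  have "integrable (M1 \<Otimes>\<^sub>M M2) (\<lambda>(x, y). g x * h y)"
  proof (rule Fubini_integrable)
    show "integrable M1 (\<lambda>x. \<integral>y. norm (case (x, y) of (x, y) \<Rightarrow> g x * h y) \<partial>M2)"
      using g h by (simp add: abs_mult)
  qed (use h in auto)
  then have int: "integrable (M1 \<Otimes>\<^sub>M M2) (case_prod f)"
    by (rule Bochner_Integration.integrable_bound)
      (auto simp: space_pair_measure intro!: AE_I2 order_trans[OF le])
  show "integrable M1 (\<lambda>x. \<integral>y. f x y \<partial>M2)" using int by (rule integrable_fst)
  show "(\<integral>x. (\<integral>y. f x y \<partial>M2) \<partial>M1) = (\<integral>y. (\<integral>x. f x y \<partial>M1) \<partial>M2)"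
    using Fubini_integral[OF int] by simp
qed

lemma integrable_continuous_bounded_support:
  fixes f :: "'a::euclidean_space \<Rightarrow> 'b::{banach, second_countable_topology}"
  assumes "continuous_on UNIV f" "\<And>x. R < norm x \<Longrightarrow> f x = 0"
  shows "integrable lborel f"
proof -
  have "integrable lborel (\<lambda>x. indicator (cball 0 R) x *\<^sub>R f x)"
    using assms(1) by (intro borel_integrable_compact) (auto intro: continuous_on_subset)
  moreover have "(\<lambda>x. indicator (cball 0 R) x *\<^sub>R f x) = f"
    using assms(2) by (auto simp: indicator_def not_le)
  ultimately show ?thesis by simp
qed

lemma test_fun_integrable: "test_fun u \<Longrightarrow> integrable lborel u"
  unfolding test_fun_def
  by (metis integrable_continuous_bounded_support real_norm_def smooth_continuous_on)

text \<open>The factor \<open>1 / (2 * pi)\<close> sits on the forward transform, as in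
  \<open>fourier\<close>: products over the coordinates then reproduce \<open>fourier\<close>
  exactly, and inversion carries no constant.\<close>

definition fourier_line :: "(real \<Rightarrow> real) \<Rightarrow> real \<Rightarrow> complex" where
  "fourier_line u s = of_real (1 / (2 * pi)) * (\<integral>z. iexp (- (z * s)) * of_real (u z) \<partial>lborel)"

lemma integrable_iexp_mult:
  assumes "integrable M g" "h \<in> borel_measurable M"
  shows "integrable M (\<lambda>z. iexp (h z) * complex_of_real (g z))"
  by (rule Bochner_Integration.integrable_bound[OF assms(1)])
    (use assms in \<open>auto simp: norm_mult simp del: of_real_mult\<close>)

lemma fourier_line_measurable:
  assumes "test_fun u" shows "fourier_line u \<in> borel_measurable borel"
proof -
  have [measurable]: "u \<in> borel_measurable borel"
    using test_fun_integrable[OF assms] by simp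
  show ?thesis unfolding fourier_line_def by measurable
qed

lemma fourier_line_bounded:
  obtains C where "\<And>s. norm (fourier_line u s) \<le> C"
proof -
  have "norm (\<integral>z. iexp (- (z * s)) * complex_of_real (u z) \<partial>lborel) \<le> (\<integral>z. \<bar>u z\<bar> \<partial>lborel)" for s
    by (rule order_trans[OF integral_norm_bound]) (simp add: norm_mult del: of_real_minus of_real_mult)
  then have "norm (fourier_line u s) \<le> 1 / (2 * pi) * (\<integral>z. \<bar>u z\<bar> \<partial>lborel)" for s
    unfolding fourier_line_def norm_mult by (intro mult_mono) (auto simp: norm_divide)
  then show ?thesis using that by blast
qed

text \<open>Integration by parts: \<open>G\<close> is the derivative of \<open>F\<close>, and the
  boundary values of \<open>F\<close> vanish because \<open>u\<close> has bounded support.\<close>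

lemma fourier_line_deriv:
  assumes "test_fun u"
  shows "fourier_line (deriv u) s = \<i> * of_real s * fourier_line u s"
proof -
  obtain R where u: "smooth u" and R: "\<And>s. R < \<bar>s\<bar> \<Longrightarrow> u s = 0"
    using assms unfolding test_fun_def by blast
  \<comment> \<open>Strictly beyond the support and positive, so that \<open>u\<close> vanishes at
    both ends of the interval from -a to a.\<close>
  define a where "a = \<bar>R\<bar> + 1"
  define F where "F z = iexp (- (z * s)) * complex_of_real (u z)" for z
  define G where "G z = iexp (- (z * s)) * complex_of_real (deriv u z)
    - \<i> * of_real s * (iexp (- (z * s)) * of_real (u z))" for z
  have FG: "(F has_vector_derivative G z) (at z within S)" for z S
  proof -
    have "((\<lambda>z. complex_of_real (u z)) has_vector_derivative complex_of_real (deriv u z)) (at z within S)"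
      using smooth_DERIV[OF u]
      by (intro has_vector_derivative_of_real) (simp add: has_field_derivative_at_within)
    moreover have "((\<lambda>z. iexp (- (z * s))) has_vector_derivative - (\<i> * of_real s) * iexp (- (z * s))) (at z within S)"
    proof -
      have "((\<lambda>w. exp (- (\<i> * of_real s) * w)) has_field_derivative
          - (\<i> * of_real s) * exp (- (\<i> * of_real s) * of_real z)) (at (of_real z))"
        by (auto intro!: derivative_eq_intros)
      from has_vector_derivative_real_field[OF this] show ?thesis by (simp add: mult_ac)
    qed
    ultimately have "(F has_vector_derivative iexp (- (z * s)) * of_real (deriv u z) +
        - (\<i> * of_real s) * iexp (- (z * s)) * of_real (u z)) (at z within S)"
      unfolding F_def by (intro has_vector_derivative_mult)
    then show ?thesis by (simp add: G_def algebra_simps)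
  qed
  have int: "integrable lborel (\<lambda>z. iexp (- (z * s)) * complex_of_real (v z))" if "test_fun v" for v
    using test_fun_integrable[OF that] by (intro integrable_iexp_mult) auto
  have "deriv u z = 0" if "a < \<bar>z\<bar>" for z
  proof (rule DERIV_imp_deriv)
    have "open {z. R < \<bar>z\<bar>}" by (intro open_Collect_less continuous_intros)
    then show "(u has_real_derivative 0) (at z)"
      by (rule has_field_derivative_transform_within_open[OF DERIV_const]) (use that R in \<open>auto simp: a_def\<close>)
  qed
  moreover have "u z = 0" if "a < \<bar>z\<bar>" for z
    by (rule R) (use that in \<open>auto simp: a_def\<close>)
  ultimately have "G z = indicator {-a..a} z *\<^sub>R G z" for z
    by (cases "\<bar>z\<bar> \<le> a") (auto simp: indicator_def G_def abs_le_iff not_le)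
  then have "(\<integral>z. G z \<partial>lborel) = (\<integral>z. indicator {-a..a} z *\<^sub>R G z \<partial>lborel)" by presburger
  also have "\<dots> = F a - F (- a)"
    by (rule integral_FTC_Icc[OF _ FG])
      (auto simp: a_def G_def intro!: continuous_intros smooth_continuous_on u smooth_deriv)
  also have "\<dots> = 0" using R by (simp add: F_def a_def)
  finally have "(\<integral>z. iexp (- (z * s)) * complex_of_real (deriv u z) \<partial>lborel) =
      \<i> * of_real s * (\<integral>z. iexp (- (z * s)) * of_real (u z) \<partial>lborel)"
    unfolding G_def using int assms test_fun_deriv
    by (subst (asm) Bochner_Integration.integral_diff) (auto simp del: of_real_minus of_real_mult)
  then show ?thesis by (simp add: fourier_line_def)
qed

text \<open>Transforming the fourth derivative bounds s^4 times the transform, hence (1 + s^2)^2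
  times it, because (1 + s^2)^2 \<le> 2 + 2 s^4. One factor 1 + s^2 is the moment wanted later, the
  other one buys integrability.\<close>

lemma fourier_line_decay:
  assumes "test_fun u"
  obtains C where "\<And>s. (1 + s\<^sup>2) * norm (fourier_line u s) \<le> C * inverse (1 + s\<^sup>2)"
proof -
  obtain C where C: "\<And>s. norm (fourier_line u s) \<le> C" using fourier_line_bounded[of u] by blast
  let ?v = "deriv (deriv (deriv (deriv u)))"
  obtain D where D: "\<And>s. norm (fourier_line ?v s) \<le> D" using fourier_line_bounded[of ?v] by blast
  have "(1 + s\<^sup>2) * norm (fourier_line u s) \<le> (2 * C + 2 * D) * inverse (1 + s\<^sup>2)" for s
  proof -
    have "fourier_line ?v s = of_real (s ^ 4) * fourier_line u s"
      using assms by (simp add: fourier_line_deriv test_fun_deriv power4_eq_xxxx mult_ac)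
    then have "s ^ 4 * norm (fourier_line u s) \<le> D" using D[of s] by (simp add: norm_mult del: of_real_power)
    moreover have "(1 + s\<^sup>2)\<^sup>2 * n \<le> 2 * n + 2 * (s ^ 4 * n)" if "0 \<le> n" for n
    proof -
      have "(1 + s\<^sup>2)\<^sup>2 \<le> 2 + 2 * s ^ 4"
        using sum_squares_ge_zero[of "s\<^sup>2 - 1" 0] by (simp add: power2_eq_square algebra_simps power4_eq_xxxx)
      from mult_right_mono[OF this that] show ?thesis by (simp add: algebra_simps)
    qed
    ultimately have "(1 + s\<^sup>2)\<^sup>2 * norm (fourier_line u s) \<le> 2 * C + 2 * D"
      using C[of s] norm_ge_zero[of "fourier_line u s"] by (smt (verit))
    moreover have "0 < 1 + s\<^sup>2" by (simp add: add_pos_nonneg)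
    ultimately show ?thesis by (simp add: field_simps power2_eq_square)
  qed
  then show ?thesis using that by blast
qed

lemma fourier_line_moment_integrable:
  assumes "test_fun u"
  shows "integrable lborel (\<lambda>s. (1 + s\<^sup>2) * norm (fourier_line u s))"
proof -
  obtain C where C: "\<And>s. (1 + s\<^sup>2) * norm (fourier_line u s) \<le> C * inverse (1 + s\<^sup>2)"
    using fourier_line_decay[OF assms] by blast
  have [measurable]: "fourier_line u \<in> borel_measurable borel" by (rule fourier_line_measurable[OF assms])
  have "integrable lborel (\<lambda>s::real. C * inverse (1 + s\<^sup>2))"
    using integrable_inverse_1_plus_square by (simp add: set_integrable_def)
  then show ?thesis
  proof (rule Bochner_Integration.integrable_bound)
    show "AE s in lborel. norm ((1 + s\<^sup>2) * norm (fourier_line u s)) \<le> norm (C * inverse (1 + s\<^sup>2))"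
      using C by (auto intro!: AE_I2 order_trans[OF _ abs_ge_self])
  qed simp
qed

lemma fourier_line_integrable:
  assumes "test_fun u" shows "integrable lborel (fourier_line u)"
proof (rule Bochner_Integration.integrable_bound[OF fourier_line_moment_integrable[OF assms]])
  show "AE s in lborel. norm (fourier_line u s) \<le> norm ((1 + s\<^sup>2) * norm (fourier_line u s))"
    by (auto intro!: AE_I2 simp: abs_mult mult_le_cancel_right1)
qed (simp add: fourier_line_measurable assms)

text \<open>The characteristic function of the standard normal law, read as saying that the Gaussian
  density is its own transform up to a constant.\<close>

lemma fourier_std_normal_density:
  "(\<integral>r. std_normal_density r *\<^sub>R iexp (t * r) \<partial>lborel) = of_real (sqrt (2 * pi) * std_normal_density t)"
proof -
  have "(\<integral>r. std_normal_density r *\<^sub>R iexp (t * r) \<partial>lborel) = char std_normal_distribution t"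
    unfolding char_def by (subst integral_density) (auto simp: normal_density_nonneg)
  also have "\<dots> = of_real (exp (- (t\<^sup>2) / 2))" by (simp only: char_std_normal_distribution)
  also have "\<dots> = of_real (sqrt (2 * pi) * std_normal_density t)" by (simp add: std_normal_density_def)
  finally show ?thesis .
qed

text \<open>The Gaussian damping factor in the inversion integral turns it into a convolution with an
  approximate identity as \<open>\<sigma>\<close> tends to \<open>0\<close>.\<close>

lemma fourier_line_gaussian_damping:
  assumes "test_fun u" "0 < \<sigma>"
  shows "(\<integral>w. of_real (u (y - \<sigma> * w)) * complex_of_real (std_normal_density w) \<partial>lborel) =
    of_real (sqrt (2 * pi)) * (\<integral>s. std_normal_density (\<sigma> * s) *\<^sub>R (iexp (y * s) * fourier_line u s) \<partial>lborel)"
proof -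
  let ?\<phi> = std_normal_density
  have u: "integrable lborel u" by (rule test_fun_integrable[OF assms(1)])
  then have [measurable]: "u \<in> borel_measurable borel" by simp
  \<comment> \<open>Substituting z = y - \<sigma> w turns the integral for fixed \<open>r\<close>
    into a phase times the transform of \<open>u\<close> at r/\<sigma>.\<close>
  have inner: "(\<integral>w. of_real (u (y - \<sigma> * w)) * iexp (w * r) \<partial>lborel) =
      of_real (2 * pi / \<sigma>) * (iexp (y * (r / \<sigma>)) * fourier_line u (r / \<sigma>))" for r
  proof -
    define f where "f z = complex_of_real (u z) * iexp ((y - z) / \<sigma> * r)" for z
    have "(\<integral>w. of_real (u (y - \<sigma> * w)) * iexp (w * r) \<partial>lborel) = (\<integral>w. f (y + (- \<sigma>) * w) \<partial>lborel)"
      using assms(2) by (simp add: f_def)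
    also have "\<dots> = of_real (1 / \<sigma>) * (\<integral>z. f z \<partial>lborel)"
      using assms(2) lborel_integral_real_affine[of "- \<sigma>" f y] by (simp add: scaleR_conv_of_real)
    also have "(\<integral>z. f z \<partial>lborel) = (\<integral>z. iexp (y * (r / \<sigma>)) * (iexp (- (z * (r / \<sigma>))) * of_real (u z)) \<partial>lborel)"
    proof (rule Bochner_Integration.integral_cong[OF refl])
      fix z
      have "(y - z) / \<sigma> * r = y * (r / \<sigma>) + (- (z * (r / \<sigma>)))"
        by (simp add: diff_divide_distrib left_diff_distrib)
      then have "iexp ((y - z) / \<sigma> * r) = iexp (y * (r / \<sigma>)) * iexp (- (z * (r / \<sigma>)))"
        by (simp only: of_real_add distrib_left exp_add)
      then show "f z = iexp (y * (r / \<sigma>)) * (iexp (- (z * (r / \<sigma>))) * of_real (u z))"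
        unfolding f_def by simp
    qed
    also have "\<dots> = iexp (y * (r / \<sigma>)) * (of_real (2 * pi) * fourier_line u (r / \<sigma>))"
      by (simp add: fourier_line_def)
    finally show ?thesis by simp
  qed
  \<comment> \<open>The density at \<open>w\<close> is replaced by its own Fourier integral over
    \<open>r\<close>, which sets up the exchange of the two integrals.\<close>
  have "(\<integral>w. of_real (u (y - \<sigma> * w)) * complex_of_real (?\<phi> w) \<partial>lborel) =
      (\<integral>w. of_real (1 / sqrt (2 * pi)) * (\<integral>r. of_real (u (y - \<sigma> * w)) * (?\<phi> r *\<^sub>R iexp (w * r)) \<partial>lborel) \<partial>lborel)"
    by (simp only: integral_mult_right_zero fourier_std_normal_density)
      (simp add: mult.left_commute[of _ "of_real (sqrt (2 * pi))"])
  also have "\<dots> = of_real (1 / sqrt (2 * pi)) *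
      (\<integral>r. (\<integral>w. of_real (u (y - \<sigma> * w)) * (?\<phi> r *\<^sub>R iexp (w * r)) \<partial>lborel) \<partial>lborel)"
  proof -
    have "(\<integral>w. (\<integral>r. of_real (u (y - \<sigma> * w)) * (?\<phi> r *\<^sub>R iexp (w * r)) \<partial>lborel) \<partial>lborel) =
      (\<integral>r. (\<integral>w. of_real (u (y - \<sigma> * w)) * (?\<phi> r *\<^sub>R iexp (w * r)) \<partial>lborel) \<partial>lborel)"
    proof (rule Fubini_dominated(2))
      show "integrable lborel (\<lambda>w. \<bar>u (y + (- \<sigma>) * w)\<bar>)"
        using u assms(2) by (intro integrable_abs lborel_integrable_real_affine) auto
      show "integrable lborel ?\<phi>" by simp
    qed (auto simp: norm_mult normal_density_nonneg lborel.sigma_finite_measure_axioms simp del: of_real_mult)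
    then show ?thesis by simp
  qed
  also have "(\<integral>r. (\<integral>w. of_real (u (y - \<sigma> * w)) * (?\<phi> r *\<^sub>R iexp (w * r)) \<partial>lborel) \<partial>lborel) =
      (\<integral>r. ?\<phi> r *\<^sub>R (of_real (2 * pi / \<sigma>) * (iexp (y * (r / \<sigma>)) * fourier_line u (r / \<sigma>))) \<partial>lborel)"
    by (simp only: inner[symmetric] mult_scaleR_right integral_scaleR_right)
  \<comment> \<open>Rescaling r = \<sigma> s cancels the factor 1/\<sigma> and leaves \<sigma> only
    inside the density, where it acts as damping.\<close>
  also have "\<dots> = \<sigma> *\<^sub>R (\<integral>s. ?\<phi> (\<sigma> * s) *\<^sub>R (of_real (2 * pi / \<sigma>) * (iexp (y * s) * fourier_line u s)) \<partial>lborel)"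
    using assms(2) by (subst lborel_integral_real_affine[of \<sigma> _ 0]) auto
  also have "\<dots> = of_real (2 * pi) * (\<integral>s. ?\<phi> (\<sigma> * s) *\<^sub>R (iexp (y * s) * fourier_line u s) \<partial>lborel)"
    using assms(2)
    by (simp only: mult_scaleR_right[symmetric] integral_mult_right_zero) (simp add: scaleR_conv_of_real)
  also have "of_real (1 / sqrt (2 * pi)) * (of_real (2 * pi) * I) = of_real (sqrt (2 * pi)) * I" for I :: complex
  proof -
    have "1 / sqrt (2 * pi) * (2 * pi) = sqrt (2 * pi)" by (simp add: real_div_sqrt)
    then show ?thesis by (metis mult.assoc of_real_mult)
  qed
  finally show ?thesis .
qed

text \<open>Let \<sigma> = 1/(n+1) tend to 0 in the damped identity. One side tends to
  \<open>u y\<close>, since \<open>u\<close> is bounded and continuous and the density has mass 1.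
  The other is dominated by the integrable transform, and the density at 0, which is 1/sqrt(2 pi),
  cancels the constant.\<close>

lemma fourier_line_inversion:
  assumes "test_fun u"
  shows "(\<integral>s. iexp (y * s) * fourier_line u s \<partial>lborel) = of_real (u y)"
proof -
  let ?\<phi> = std_normal_density
  let ?s = "\<lambda>n. 1 / real (Suc n)"
  obtain R where u: "smooth u" and R: "\<And>s. R < \<bar>s\<bar> \<Longrightarrow> u s = 0"
    using assms unfolding test_fun_def by blast
  obtain B where B: "\<And>s. \<bar>u s\<bar> \<le> B"
  proof -
    have "compact (u ` {-\<bar>R\<bar>..\<bar>R\<bar>})" by (intro compact_continuous_image smooth_continuous_on u) auto
    then obtain b where "\<And>s. s \<in> {-\<bar>R\<bar>..\<bar>R\<bar>} \<Longrightarrow> \<bar>u s\<bar> \<le> b" by (force dest!: compact_imp_bounded simp: bounded_iff)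
    then have "\<bar>u s\<bar> \<le> \<bar>b\<bar>" for s using R[of s] by (cases "s \<in> {-\<bar>R\<bar>..\<bar>R\<bar>}") force+
    then show ?thesis using that by blast
  qed
  have [measurable]: "u \<in> borel_measurable borel" using test_fun_integrable[OF assms] by simp
  have [measurable]: "fourier_line u \<in> borel_measurable borel" by (rule fourier_line_measurable[OF assms])
  have s0: "(\<lambda>n. ?s n * c) \<longlonglongrightarrow> 0 * c" for c
    by (intro tendsto_intros LIMSEQ_inverse_real_of_nat[unfolded inverse_eq_divide])
  have "(\<lambda>n. \<integral>w. of_real (u (y - ?s n * w)) * complex_of_real (?\<phi> w) \<partial>lborel)
      \<longlonglongrightarrow> (\<integral>w. of_real (u y) * complex_of_real (?\<phi> w) \<partial>lborel)"
  proof (rule integral_dominated_convergence[where w = "\<lambda>w. B * ?\<phi> w"])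
    have "(\<lambda>n. u (y - ?s n * w)) \<longlonglongrightarrow> u (y - 0 * w)" for w
      using smooth_continuous_on[OF u, of UNIV] s0[of w]
      by (intro continuous_on_tendsto_compose[of UNIV u] tendsto_diff) auto
    then show "AE w in lborel. (\<lambda>n. of_real (u (y - ?s n * w)) * complex_of_real (?\<phi> w))
        \<longlonglongrightarrow> of_real (u y) * complex_of_real (?\<phi> w)"
      by (auto intro!: tendsto_intros)
  qed (auto simp: norm_mult normal_density_nonneg intro!: mult_right_mono B)
  also have "(\<integral>w. of_real (u y) * complex_of_real (?\<phi> w) \<partial>lborel) = of_real (u y)"
    by simp
  finally have 1: "(\<lambda>n. \<integral>w. of_real (u (y - ?s n * w)) * complex_of_real (?\<phi> w) \<partial>lborel) \<longlonglongrightarrow> of_real (u y)" .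
  have "(\<lambda>n. \<integral>s. ?\<phi> (?s n * s) *\<^sub>R (iexp (y * s) * fourier_line u s) \<partial>lborel)
      \<longlonglongrightarrow> (\<integral>s. ?\<phi> 0 *\<^sub>R (iexp (y * s) * fourier_line u s) \<partial>lborel)"
  proof (rule integral_dominated_convergence[where w = "\<lambda>s. norm (fourier_line u s)"])
    have "(\<lambda>n. ?\<phi> (?s n * s)) \<longlonglongrightarrow> ?\<phi> (0 * s)" for s
      by (intro continuous_on_tendsto_compose[of UNIV ?\<phi>] s0)
        (auto simp: std_normal_density_def intro!: continuous_intros)
    then show "AE s in lborel. (\<lambda>n. ?\<phi> (?s n * s) *\<^sub>R (iexp (y * s) * fourier_line u s))
        \<longlonglongrightarrow> ?\<phi> 0 *\<^sub>R (iexp (y * s) * fourier_line u s)"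
      by (auto intro!: tendsto_intros)
    have "?\<phi> x \<le> 1" for x
    proof -
      have "1 \<le> sqrt (2 * pi)" using pi_gt3 by simp
      moreover have "exp (- x\<^sup>2 / 2) \<le> 1" by simp
      ultimately have "exp (- x\<^sup>2 / 2) \<le> sqrt (2 * pi)" by linarith
      then show ?thesis by (simp add: std_normal_density_def)
    qed
    then show "AE s in lborel. norm (?\<phi> (?s n * s) *\<^sub>R (iexp (y * s) * fourier_line u s)) \<le> norm (fourier_line u s)" for n
      by (auto simp: norm_mult normal_density_nonneg mult_left_le_one_le simp del: of_real_mult)
  qed (use fourier_line_integrable[OF assms] in auto)
  then have "(\<lambda>n. of_real (sqrt (2 * pi)) * (\<integral>s. ?\<phi> (?s n * s) *\<^sub>R (iexp (y * s) * fourier_line u s) \<partial>lborel))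
      \<longlonglongrightarrow> of_real (sqrt (2 * pi)) * (\<integral>s. ?\<phi> 0 *\<^sub>R (iexp (y * s) * fourier_line u s) \<partial>lborel)"
    by (intro tendsto_intros)
  also have "of_real (sqrt (2 * pi)) * (\<integral>s. ?\<phi> 0 *\<^sub>R (iexp (y * s) * fourier_line u s) \<partial>lborel) =
      (\<integral>s. iexp (y * s) * fourier_line u s \<partial>lborel)"
    by (simp add: std_normal_density_def scaleR_conv_of_real)
  finally have "(\<lambda>n. \<integral>w. of_real (u (y - ?s n * w)) * complex_of_real (?\<phi> w) \<partial>lborel)
      \<longlonglongrightarrow> (\<integral>s. iexp (y * s) * fourier_line u s \<partial>lborel)"
    by (subst fourier_line_gaussian_damping[OF assms]) auto
  from LIMSEQ_unique[OF this 1] show ?thesis .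
qed

section \<open>Fourier inversion for tensor products\<close>

text \<open>\<open>lborel\<close> is the image of the product of one-dimensional Lebesgue measures
  under the map from coordinates to vectors, so the product-measure results carry over.\<close>

lemma lborel_prod_Basis:
  fixes f :: "'a::euclidean_space \<Rightarrow> real \<Rightarrow> 'c::{real_normed_field, banach, second_countable_topology}"
  assumes "\<And>b. b \<in> Basis \<Longrightarrow> integrable lborel (f b)"
  shows "integrable lborel (\<lambda>x. \<Prod>b\<in>Basis. f b (x \<bullet> b))"
    and "(\<integral>x. (\<Prod>b\<in>Basis. f b (x \<bullet> b)) \<partial>lborel) = (\<Prod>b\<in>Basis. \<integral>s. f b s \<partial>lborel)"
proof -
  interpret product_sigma_finite "\<lambda>_::'a. lborel :: real measure" by standard
  have [measurable]: "f b \<in> borel_measurable borel" if "b \<in> Basis" for b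
    using assms[OF that] by simp
  have eq: "(\<Prod>b\<in>Basis. f b ((\<Sum>c\<in>Basis. x c *\<^sub>R c) \<bullet> b)) = (\<Prod>b\<in>Basis. f b (x b))" for x
    by (intro prod.cong refl arg_cong[of _ _ "f _"]) (simp add: inner_sum_left inner_Basis if_distrib cong: if_cong)
  have meas: "(\<lambda>x. \<Prod>b\<in>Basis. f b (x \<bullet> b)) \<in> borel_measurable borel" by measurable
  show "integrable lborel (\<lambda>x. \<Prod>b\<in>Basis. f b (x \<bullet> b))"
    unfolding lborel_eq[where 'a = 'a] using meas
    by (subst integrable_distr_eq) (auto simp: eq intro!: product_integrable_prod assms)
  show "(\<integral>x. (\<Prod>b\<in>Basis. f b (x \<bullet> b)) \<partial>lborel) = (\<Prod>b\<in>Basis. \<integral>s. f b s \<partial>lborel)"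
    unfolding lborel_eq[where 'a = 'a] using meas
    by (subst integral_distr) (auto simp: eq intro!: product_integral_prod assms)
qed

lemma iexp_inner: "iexp (x \<bullet> y) = (\<Prod>b\<in>Basis. iexp ((x \<bullet> b) * (y \<bullet> b)))"
  by (subst euclidean_inner) (simp add: exp_sum sum_distrib_left)

text \<open>What the symbol computation uses of a transform: measurability, a second moment and the
  inversion formula. The forward transform does not occur, so this makes sense on every Euclidean
  space, while \<open>fourier\<close> is tied to \<open>real ^ 'n\<close>.\<close>

definition fourier_pair :: "('a::euclidean_space \<Rightarrow> real) \<Rightarrow> ('a \<Rightarrow> complex) \<Rightarrow> bool" where
  "fourier_pair w G \<longleftrightarrow> G \<in> borel_measurable borel \<and>
     integrable lborel (\<lambda>\<xi>. (1 + (norm \<xi>)\<^sup>2) * norm (G \<xi>)) \<and>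
     (\<forall>y. (\<integral>\<xi>. iexp (y \<bullet> \<xi>) * G \<xi> \<partial>lborel) = of_real (w y))"

lemma fourier_pair_integrable:
  assumes "fourier_pair w G" shows "integrable lborel G"
proof (rule Bochner_Integration.integrable_bound)
  show "integrable lborel (\<lambda>\<xi>. (1 + (norm \<xi>)\<^sup>2) * norm (G \<xi>))" "G \<in> borel_measurable lborel"
    using assms by (auto simp: fourier_pair_def)
  show "AE \<xi> in lborel. norm (G \<xi>) \<le> norm ((1 + (norm \<xi>)\<^sup>2) * norm (G \<xi>))"
    by (auto intro!: AE_I2 simp: abs_mult mult_le_cancel_right1)
qed

lemma fourier_pair_integrable_iexp:
  assumes "fourier_pair w G" shows "integrable lborel (\<lambda>\<xi>. iexp (y \<bullet> \<xi>) * G \<xi>)"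
proof (rule Bochner_Integration.integrable_bound[OF fourier_pair_integrable[OF assms]])
  show "(\<lambda>\<xi>. iexp (y \<bullet> \<xi>) * G \<xi>) \<in> borel_measurable lborel"
    using assms by (auto simp: fourier_pair_def)
qed (simp add: norm_mult)

lemma fourier_pair_add:
  assumes w: "fourier_pair w G" and v: "fourier_pair v H"
  shows "fourier_pair (\<lambda>y. w y + v y) (\<lambda>\<xi>. G \<xi> + H \<xi>)"
proof -
  have [measurable]: "G \<in> borel_measurable borel" "H \<in> borel_measurable borel"
    using assms by (auto simp: fourier_pair_def)
  have "integrable lborel (\<lambda>\<xi>. (1 + (norm \<xi>)\<^sup>2) * norm (G \<xi>) + (1 + (norm \<xi>)\<^sup>2) * norm (H \<xi>))"
    using assms by (auto simp: fourier_pair_def)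
  then have "integrable lborel (\<lambda>\<xi>. (1 + (norm \<xi>)\<^sup>2) * norm (G \<xi> + H \<xi>))"
  proof (rule Bochner_Integration.integrable_bound)
    show "AE \<xi> in lborel. norm ((1 + (norm \<xi>)\<^sup>2) * norm (G \<xi> + H \<xi>))
        \<le> norm ((1 + (norm \<xi>)\<^sup>2) * norm (G \<xi>) + (1 + (norm \<xi>)\<^sup>2) * norm (H \<xi>))"
      by (auto intro!: AE_I2 mult_left_mono norm_triangle_ineq simp: abs_mult simp flip: distrib_left)
  qed simp
  moreover have "(\<integral>\<xi>. iexp (y \<bullet> \<xi>) * (G \<xi> + H \<xi>) \<partial>lborel) = of_real (w y + v y)" for y
    using assms fourier_pair_integrable_iexp[OF w] fourier_pair_integrable_iexp[OF v]
    by (simp add: distrib_left fourier_pair_def)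
  ultimately show ?thesis unfolding fourier_pair_def by auto
qed

lemma fourier_pair_prod:
  fixes u :: "'a::euclidean_space \<Rightarrow> real \<Rightarrow> real"
  assumes u: "\<And>b. b \<in> Basis \<Longrightarrow> test_fun (u b)"
  shows "fourier_pair (\<lambda>y. \<Prod>b\<in>Basis. u b (y \<bullet> b)) (\<lambda>\<xi>. \<Prod>b\<in>Basis. fourier_line (u b) (\<xi> \<bullet> b))"
proof -
  let ?G = "\<lambda>\<xi>. \<Prod>b\<in>Basis. fourier_line (u b) (\<xi> \<bullet> b)"
  have [measurable]: "fourier_line (u b) \<in> borel_measurable borel" if "b \<in> Basis" for b
    using u that fourier_line_measurable by blast
  have meas: "?G \<in> borel_measurable borel" by measurable
  have "integrable lborel (\<lambda>\<xi>::'a. \<Prod>b\<in>Basis. (1 + (\<xi> \<bullet> b)\<^sup>2) * norm (fourier_line (u b) (\<xi> \<bullet> b)))"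
    using u by (intro lborel_prod_Basis(1)) (rule fourier_line_moment_integrable)
  then have "integrable lborel (\<lambda>\<xi>. (1 + (norm \<xi>)\<^sup>2) * norm (?G \<xi>))"
  proof (rule Bochner_Integration.integrable_bound)
    \<comment> \<open>Expanding the product yields the left side plus nonnegative terms. The
      multidimensional second moment is thereby dominated by a product of one-dimensional
      ones.\<close>
    have "1 + (\<Sum>b\<in>I. (\<xi> \<bullet> b)\<^sup>2) \<le> (\<Prod>b\<in>I. 1 + (\<xi> \<bullet> b)\<^sup>2)" if "finite I" for I and \<xi> :: 'a
      using that
    proof induction
      case (insert c I)
      then have "(1 + (\<xi> \<bullet> c)\<^sup>2) * (1 + (\<Sum>b\<in>I. (\<xi> \<bullet> b)\<^sup>2)) \<le> (1 + (\<xi> \<bullet> c)\<^sup>2) * (\<Prod>b\<in>I. 1 + (\<xi> \<bullet> b)\<^sup>2)"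
        by (intro mult_left_mono) auto
      moreover have "0 \<le> (\<xi> \<bullet> c)\<^sup>2 * (\<Sum>b\<in>I. (\<xi> \<bullet> b)\<^sup>2)" by (intro mult_nonneg_nonneg sum_nonneg) auto
      ultimately show ?case using insert by (simp add: algebra_simps)
    qed simp
    from this[OF finite_Basis] have "1 + (norm \<xi>)\<^sup>2 \<le> (\<Prod>b\<in>Basis. 1 + (\<xi> \<bullet> b)\<^sup>2)" for \<xi> :: 'a
      by (simp add: norm_eq_sqrt_inner euclidean_inner[of \<xi> \<xi>] power2_eq_square sum_nonneg)
    then have "(1 + (norm \<xi>)\<^sup>2) * norm (?G \<xi>) \<le>
        (\<Prod>b\<in>Basis. (1 + (\<xi> \<bullet> b)\<^sup>2) * norm (fourier_line (u b) (\<xi> \<bullet> b)))" for \<xi> :: 'a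
      unfolding prod_norm[symmetric] prod.distrib by (rule mult_right_mono) (simp add: prod_nonneg)
    then show "AE \<xi> in lborel. norm ((1 + (norm \<xi>)\<^sup>2) * norm (?G \<xi>)) \<le>
        norm (\<Prod>b\<in>Basis. (1 + (\<xi> \<bullet> b)\<^sup>2) * norm (fourier_line (u b) (\<xi> \<bullet> b)))"
      by (intro AE_I2) (simp add: abs_mult prod_nonneg)
  qed (use meas in measurable)
  moreover have "(\<integral>\<xi>. iexp (y \<bullet> \<xi>) * ?G \<xi> \<partial>lborel) = of_real (\<Prod>b\<in>Basis. u b (y \<bullet> b))" for y
  proof -
    have "iexp (y \<bullet> \<xi>) * ?G \<xi> = (\<Prod>b\<in>Basis. iexp ((y \<bullet> b) * (\<xi> \<bullet> b)) * fourier_line (u b) (\<xi> \<bullet> b))" for \<xi>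
      unfolding iexp_inner by (rule prod.distrib[symmetric])
    then have "(\<integral>\<xi>. iexp (y \<bullet> \<xi>) * ?G \<xi> \<partial>lborel) =
        (\<Prod>b\<in>Basis. \<integral>s. iexp ((y \<bullet> b) * s) * fourier_line (u b) s \<partial>lborel)"
    proof (simp only:, intro lborel_prod_Basis(2))
      fix b :: 'a assume "b \<in> Basis"
      then show "integrable lborel (\<lambda>s. iexp ((y \<bullet> b) * s) * fourier_line (u b) s)"
        by (intro Bochner_Integration.integrable_bound[OF fourier_line_integrable[OF u]])
          (auto simp: norm_mult simp del: of_real_mult)
    qed
    also have "\<dots> = (\<Prod>b\<in>Basis. of_real (u b (y \<bullet> b)))"
      by (intro prod.cong refl fourier_line_inversion u)
    finally show ?thesis by simp
  qed
  ultimately show ?thesis unfolding fourier_pair_def using meas by blast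
qed

lemma fourier_prod:
  fixes u :: "real ^ 'n \<Rightarrow> real \<Rightarrow> real"
  assumes u: "\<And>b. b \<in> Basis \<Longrightarrow> test_fun (u b)"
  shows "fourier (\<lambda>y. \<Prod>b\<in>Basis. u b (y \<bullet> b)) \<xi> = (\<Prod>b\<in>Basis. fourier_line (u b) (\<xi> \<bullet> b))"
proof -
  have "exp (- \<i> * of_real (y \<bullet> \<xi>)) * of_real (\<Prod>b\<in>Basis. u b (y \<bullet> b)) =
      (\<Prod>b\<in>Basis. iexp (- ((y \<bullet> b) * (\<xi> \<bullet> b))) * of_real (u b (y \<bullet> b)))" for y
  proof -
    have "exp (- \<i> * of_real (y \<bullet> \<xi>)) = iexp ((- y) \<bullet> \<xi>)" by simp
    then show ?thesis unfolding iexp_inner by (simp add: prod.distrib)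
  qed
  then have "(\<integral>y. exp (- \<i> * of_real (y \<bullet> \<xi>)) * of_real (\<Prod>b\<in>Basis. u b (y \<bullet> b)) \<partial>lborel) =
      (\<Prod>b\<in>Basis. \<integral>s. iexp (- (s * (\<xi> \<bullet> b))) * of_real (u b s) \<partial>lborel)"
  proof (simp only:, intro lborel_prod_Basis(2))
    show "integrable lborel (\<lambda>s. iexp (- (s * (\<xi> \<bullet> b))) * complex_of_real (u b s))" if "b \<in> Basis" for b
      using test_fun_integrable[OF u[OF that]] by (intro integrable_iexp_mult) auto
  qed
  moreover have "(\<Prod>b\<in>(Basis :: (real ^ 'n) set). complex_of_real (1 / (2 * pi))) = 1 / (2 * pi) ^ CARD('n)"
    by (simp add: prod_constant power_divide)
  ultimately show ?thesis unfolding fourier_def fourier_line_def prod.distrib by simp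
qed

lemma tensor_test_fourier_pair:
  fixes w :: "real ^ 'n \<Rightarrow> real"
  assumes "w \<in> tensor_test" shows "fourier_pair w (fourier w)"
  using assms
proof induction
  case (prod u)
  then have "fourier (\<lambda>y. \<Prod>b\<in>Basis. u b (y \<bullet> b)) = (\<lambda>\<xi>. \<Prod>b\<in>Basis. fourier_line (u b) (\<xi> \<bullet> b))"
    by (intro ext fourier_prod)
  with fourier_pair_prod[of u] prod show ?case by simp
next
  case (add g h)
  have int: "integrable lborel (\<lambda>y. exp (- \<i> * of_real (y \<bullet> \<xi>)) * complex_of_real (k y))"
    if "k \<in> tensor_test" for k :: "real ^ 'n \<Rightarrow> real" and \<xi>
  proof -
    obtain R where "\<And>y. R < norm y \<Longrightarrow> k y = 0" using tensor_test_support[OF \<open>k \<in> tensor_test\<close>] by blast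
    then have "integrable lborel k"
      using integrable_continuous_bounded_support[of k R] tensor_test_continuous_on that by blast
    then have "integrable lborel (\<lambda>y. iexp (- (y \<bullet> \<xi>)) * complex_of_real (k y))"
      by (rule integrable_iexp_mult) simp
    then show ?thesis by simp
  qed
  have "fourier (\<lambda>y. g y + h y) \<xi> = fourier g \<xi> + fourier h \<xi>" for \<xi>
    unfolding fourier_def using int[OF add.hyps(1)] int[OF add.hyps(2)]
    by (simp add: distrib_left)
  then have "fourier (\<lambda>y. g y + h y) = (\<lambda>\<xi>. fourier g \<xi> + fourier h \<xi>)" by (rule ext)
  with fourier_pair_add[OF add.IH] show ?case by simp
qed

section \<open>The symbol applied to functions vanishing near a point\<close>

text \<open>The inversion integral vanishes on the ball, hence so do its difference quotients in
  direction \<open>v\<close>, and their dominated limit is \<open>\<i>\<close> times the claimed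
  integral. The claim covers every point of the ball, not only its centre, so that the lemma can be
  applied again to its own conclusion.\<close>

lemma fourier_directional_moment_zero:
  fixes H :: "'a::euclidean_space \<Rightarrow> complex"
  assumes [measurable]: "H \<in> borel_measurable borel"
    and int: "integrable lborel (\<lambda>\<xi>. (1 + norm \<xi>) * norm (H \<xi>))"
    and zero: "\<And>y. y \<in> ball x \<delta> \<Longrightarrow> (\<integral>\<xi>. iexp (y \<bullet> \<xi>) * H \<xi> \<partial>lborel) = 0"
    and y: "y \<in> ball x \<delta>"
  shows "(\<integral>\<xi>. iexp (y \<bullet> \<xi>) * (of_real (v \<bullet> \<xi>) * H \<xi>) \<partial>lborel) = 0"
proof -
  \<comment> \<open>Steps of length at most \<open>e\<close> along \<open>v\<close> stay in the
    ball; the 1 in the denominator keeps it positive when \<open>v = 0\<close>.\<close>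
  define e where "e = (\<delta> - dist x y) / (1 + norm v)"
  have e: "0 < e" using y by (simp add: e_def add_pos_nonneg)
  define s where "s n = e / real (Suc n)" for n
  have s_pos: "0 < s n" for n using e by (simp add: s_def)
  have s_le: "s n \<le> e" for n using e by (simp add: s_def divide_le_eq mult_le_cancel_left1)
  have s_lim: "filterlim (\<lambda>n. complex_of_real (s n)) (at 0) sequentially"
  proof -
    have "(\<lambda>n. e * inverse (real (Suc n))) \<longlonglongrightarrow> e * 0"
      by (intro tendsto_intros LIMSEQ_inverse_real_of_nat)
    then have "s \<longlonglongrightarrow> 0" by (simp add: s_def[abs_def] divide_inverse)
    then have "(\<lambda>n. complex_of_real (s n)) \<longlonglongrightarrow> complex_of_real 0" by (rule tendsto_of_real)
    then show ?thesis using s_pos by (simp add: filterlim_at less_imp_neq[symmetric])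
  qed
  have intH: "integrable lborel (\<lambda>\<xi>. iexp (z \<bullet> \<xi>) * H \<xi>)" for z
    by (rule Bochner_Integration.integrable_bound[OF int])
      (auto simp: norm_mult abs_mult mult_le_cancel_right1)
  have near: "y + s n *\<^sub>R v \<in> ball x \<delta>" for n
  proof -
    have "s n * norm v \<le> e * norm v" using s_le by (simp add: mult_right_mono)
    also have "\<dots> < e * (1 + norm v)" using e by simp
    also have "\<dots> = \<delta> - dist x y"
      unfolding e_def using norm_ge_zero[of v] by (simp add: add_nonneg_eq_0_iff)
    finally have "dist y (y + s n *\<^sub>R v) < \<delta> - dist x y"
      using s_pos[of n] by (simp add: dist_norm)
    then show ?thesis using dist_triangle[of x "y + s n *\<^sub>R v" y] by simp
  qed
  have "(\<lambda>n. \<integral>\<xi>. iexp (y \<bullet> \<xi>) * H \<xi> * ((iexp (s n * (v \<bullet> \<xi>)) - 1) / of_real (s n)) \<partial>lborel)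
      \<longlonglongrightarrow> (\<integral>\<xi>. iexp (y \<bullet> \<xi>) * H \<xi> * (\<i> * of_real (v \<bullet> \<xi>)) \<partial>lborel)"
  proof (rule integral_dominated_convergence)
    show "integrable lborel (\<lambda>\<xi>. norm v * ((1 + norm \<xi>) * norm (H \<xi>)))" using int by simp
    show "AE \<xi> in lborel. (\<lambda>n. iexp (y \<bullet> \<xi>) * H \<xi> * ((iexp (s n * (v \<bullet> \<xi>)) - 1) / of_real (s n)))
        \<longlonglongrightarrow> iexp (y \<bullet> \<xi>) * H \<xi> * (\<i> * of_real (v \<bullet> \<xi>))"
    proof (rule AE_I2)
      fix \<xi>
      have "((\<lambda>z. exp (\<i> * of_real (v \<bullet> \<xi>) * z)) has_field_derivative \<i> * of_real (v \<bullet> \<xi>)) (at 0)"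
        by (auto intro!: derivative_eq_intros)
      then have "((\<lambda>h. (exp (\<i> * of_real (v \<bullet> \<xi>) * h) - 1) / h) \<longlongrightarrow> \<i> * of_real (v \<bullet> \<xi>)) (at 0)"
        by (simp add: DERIV_def)
      from filterlim_compose[OF this s_lim]
      have "(\<lambda>n. (iexp (s n * (v \<bullet> \<xi>)) - 1) / of_real (s n)) \<longlonglongrightarrow> \<i> * of_real (v \<bullet> \<xi>)"
        by (simp add: mult_ac)
      then show "(\<lambda>n. iexp (y \<bullet> \<xi>) * H \<xi> * ((iexp (s n * (v \<bullet> \<xi>)) - 1) / of_real (s n)))
        \<longlonglongrightarrow> iexp (y \<bullet> \<xi>) * H \<xi> * (\<i> * of_real (v \<bullet> \<xi>))"
        by (intro tendsto_intros)
    qed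
    show "AE \<xi> in lborel. norm (iexp (y \<bullet> \<xi>) * H \<xi> * ((iexp (s n * (v \<bullet> \<xi>)) - 1) / of_real (s n)))
        \<le> norm v * ((1 + norm \<xi>) * norm (H \<xi>))" for n
    proof (rule AE_I2)
      fix \<xi>
      have "norm (iexp (s n * (v \<bullet> \<xi>)) - 1) \<le> \<bar>s n * (v \<bullet> \<xi>)\<bar>"
        using iexp_approx1[of "s n * (v \<bullet> \<xi>)" 0] by simp
      also have "\<dots> \<le> s n * (norm v * (1 + norm \<xi>))"
      proof -
        have "\<bar>v \<bullet> \<xi>\<bar> \<le> norm v * (1 + norm \<xi>)"
          by (rule order_trans[OF Cauchy_Schwarz_ineq2]) (simp add: mult_left_mono)
        then show ?thesis using s_pos[of n] by (simp add: abs_mult mult_left_mono)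
      qed
      finally have "norm ((iexp (s n * (v \<bullet> \<xi>)) - 1) / of_real (s n)) \<le> norm v * (1 + norm \<xi>)"
        using s_pos[of n] by (simp add: norm_divide divide_le_eq mult_ac)
      then show "norm (iexp (y \<bullet> \<xi>) * H \<xi> * ((iexp (s n * (v \<bullet> \<xi>)) - 1) / of_real (s n)))
        \<le> norm v * ((1 + norm \<xi>) * norm (H \<xi>))"
        unfolding norm_mult norm_exp_i_times
        by (metis (no_types, opaque_lifting) mult.commute mult.left_commute mult_1 mult_left_mono norm_ge_zero)
    qed
  qed measurable
  \<comment> \<open>Each quotient is a difference of inversion integrals at two points of the ball,
    and both are 0.\<close>
  moreover have "(\<integral>\<xi>. iexp (y \<bullet> \<xi>) * H \<xi> * ((iexp (s n * (v \<bullet> \<xi>)) - 1) / of_real (s n)) \<partial>lborel) = 0" for n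
  proof -
    have "iexp (y \<bullet> \<xi>) * H \<xi> * ((iexp (s n * (v \<bullet> \<xi>)) - 1) / of_real (s n)) =
        (iexp ((y + s n *\<^sub>R v) \<bullet> \<xi>) * H \<xi> - iexp (y \<bullet> \<xi>) * H \<xi>) / of_real (s n)" for \<xi>
      by (simp add: inner_add_left distrib_left exp_add algebra_simps diff_divide_distrib)
    then show ?thesis
      using zero[OF near] zero[OF y] by (simp only: integral_divide_zero Bochner_Integration.integral_diff[OF intH intH]) simp
  qed
  ultimately have "(\<integral>\<xi>. iexp (y \<bullet> \<xi>) * H \<xi> * (\<i> * of_real (v \<bullet> \<xi>)) \<partial>lborel) = 0"
    by (simp only:) (rule LIMSEQ_unique[OF _ tendsto_const])
  moreover have "iexp (y \<bullet> \<xi>) * H \<xi> * (\<i> * of_real (v \<bullet> \<xi>)) = \<i> * (iexp (y \<bullet> \<xi>) * (of_real (v \<bullet> \<xi>) * H \<xi>))" for \<xi>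
    by (simp add: mult_ac)
  ultimately show ?thesis by (simp only: integral_mult_right_zero) simp
qed

text \<open>Up to powers of \<open>\<i>\<close> these are first and second directional derivatives
  of \<open>w\<close> at \<open>x\<close>. The second follows from the first-order result applied to
  \<open>of_real (v \<bullet> \<xi>) * G \<xi>\<close>, whose inversion integral vanishes on the
  ball by the first application.\<close>

lemma fourier_pair_moments_zero:
  assumes wG: "fourier_pair w G" and "0 < \<delta>" and w: "\<And>y. y \<in> ball x \<delta> \<Longrightarrow> w y = 0"
  shows "(\<integral>\<xi>. iexp (x \<bullet> \<xi>) * (of_real (v \<bullet> \<xi>) * G \<xi>) \<partial>lborel) = 0"
    and "(\<integral>\<xi>. iexp (x \<bullet> \<xi>) * (of_real (u \<bullet> \<xi>) * (of_real (v \<bullet> \<xi>) * G \<xi>)) \<partial>lborel) = 0"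
proof -
  have [measurable]: "G \<in> borel_measurable borel" using wG by (simp add: fourier_pair_def)
  have int: "integrable lborel (\<lambda>\<xi>. (1 + (norm \<xi>)\<^sup>2) * norm (G \<xi>))" using wG by (simp add: fourier_pair_def)
  \<comment> \<open>Both first-order weights, for \<open>G\<close> and for its first moment, reduce
    to the second moment of the pair.\<close>
  have le: "(1 + n) \<le> 2 * (1 + n\<^sup>2)" "(1 + n) * n \<le> 2 * (1 + n\<^sup>2)" for n :: real
  proof -
    have "2 * n \<le> 1 + n\<^sup>2" using zero_le_power2[of "n - 1"] by (simp add: power2_diff)
    moreover have "0 \<le> n\<^sup>2" "(1 + n) * n = n + n\<^sup>2" by (auto simp: power2_eq_square algebra_simps)
    ultimately have "(1 + n) \<le> 2 * (1 + n\<^sup>2) \<and> (1 + n) * n \<le> 2 * (1 + n\<^sup>2)" by argo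
    then show "(1 + n) \<le> 2 * (1 + n\<^sup>2)" "(1 + n) * n \<le> 2 * (1 + n\<^sup>2)" by auto
  qed
  have int1: "integrable lborel (\<lambda>\<xi>. (1 + norm \<xi>) * norm (G \<xi>))"
  proof (rule Bochner_Integration.integrable_bound)
    show "integrable lborel (\<lambda>\<xi>. 2 * ((1 + (norm \<xi>)\<^sup>2) * norm (G \<xi>)))" using int by simp
    show "AE \<xi> in lborel. norm ((1 + norm \<xi>) * norm (G \<xi>)) \<le> norm (2 * ((1 + (norm \<xi>)\<^sup>2) * norm (G \<xi>)))"
      using le(1) by (auto intro!: AE_I2 mult_right_mono simp: abs_mult simp flip: mult.assoc)
  qed simp
  have int2: "integrable lborel (\<lambda>\<xi>. (1 + norm \<xi>) * norm (of_real (v \<bullet> \<xi>) * G \<xi>))"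
  proof (rule Bochner_Integration.integrable_bound)
    show "integrable lborel (\<lambda>\<xi>. norm v * (2 * ((1 + (norm \<xi>)\<^sup>2) * norm (G \<xi>))))" using int by simp
    show "AE \<xi> in lborel. norm ((1 + norm \<xi>) * norm (of_real (v \<bullet> \<xi>) * G \<xi>))
        \<le> norm (norm v * (2 * ((1 + (norm \<xi>)\<^sup>2) * norm (G \<xi>))))"
    proof (rule AE_I2)
      fix \<xi>
      have "(1 + norm \<xi>) * \<bar>v \<bullet> \<xi>\<bar> \<le> (1 + norm \<xi>) * (norm v * norm \<xi>)"
        using Cauchy_Schwarz_ineq2[of v \<xi>] by (intro mult_left_mono) auto
      also have "\<dots> = norm v * ((1 + norm \<xi>) * norm \<xi>)" by (simp add: mult_ac)
      also have "\<dots> \<le> norm v * (2 * (1 + (norm \<xi>)\<^sup>2))" by (intro mult_left_mono le) auto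
      finally have "(1 + norm \<xi>) * \<bar>v \<bullet> \<xi>\<bar> * norm (G \<xi>) \<le> norm v * (2 * (1 + (norm \<xi>)\<^sup>2)) * norm (G \<xi>)"
        by (rule mult_right_mono) simp
      then show "norm ((1 + norm \<xi>) * norm (of_real (v \<bullet> \<xi>) * G \<xi>))
        \<le> norm (norm v * (2 * ((1 + (norm \<xi>)\<^sup>2) * norm (G \<xi>))))"
        by (simp add: abs_mult norm_mult mult.assoc del: distrib_left_numeral)
    qed
  qed simp
  have 0: "(\<integral>\<xi>. iexp (y \<bullet> \<xi>) * G \<xi> \<partial>lborel) = 0" if "y \<in> ball x \<delta>" for y
    using wG w[OF that] by (simp add: fourier_pair_def)
  have 1: "(\<integral>\<xi>. iexp (y \<bullet> \<xi>) * (of_real (v \<bullet> \<xi>) * G \<xi>) \<partial>lborel) = 0" if "y \<in> ball x \<delta>" for y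
    by (rule fourier_directional_moment_zero[OF _ int1 0 that]) auto
  have x: "x \<in> ball x \<delta>" using \<open>0 < \<delta>\<close> by simp
  show "(\<integral>\<xi>. iexp (x \<bullet> \<xi>) * (of_real (v \<bullet> \<xi>) * G \<xi>) \<partial>lborel) = 0" by (rule 1[OF x])
  show "(\<integral>\<xi>. iexp (x \<bullet> \<xi>) * (of_real (u \<bullet> \<xi>) * (of_real (v \<bullet> \<xi>) * G \<xi>)) \<partial>lborel) = 0"
    by (rule fourier_directional_moment_zero[OF _ int2 1 x]) auto
qed

text \<open>The level sets where \<open>h\<close> is at least 1/(n+1) cover the space by positivity
  and have finite measure by Markov's inequality. For a Levy measure \<open>h\<close> is
  \<open>min ((norm y)\<^sup>2) 1\<close>, positive because the origin is excluded.\<close>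

lemma sigma_finite_measure_integrable_pos:
  fixes h :: "'a \<Rightarrow> real"
  assumes "integrable N h" "\<And>y. y \<in> space N \<Longrightarrow> 0 < h y"
  shows "sigma_finite_measure N"
proof (rule sigma_finite_measure.intro, intro exI conjI)
  have [measurable]: "h \<in> borel_measurable N" using assms by simp
  let ?A = "\<lambda>n. {y \<in> space N. 1 / real (Suc n) \<le> h y}"
  show "countable (range ?A)" by simp
  show "range ?A \<subseteq> sets N" by auto
  show "\<Union>(range ?A) = space N"
  proof safe
    fix y assume y: "y \<in> space N"
    obtain n where "1 / real (Suc n) < h y" using assms(2)[OF y] by (metis nat_approx_posE)
    with y show "y \<in> \<Union>(range ?A)" by (auto intro!: exI[of _ n])
  qed
  show "\<forall>a\<in>range ?A. emeasure N a \<noteq> \<infinity>"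
  proof safe
    fix n assume *: "emeasure N (?A n) = \<infinity>"
    have "emeasure N (?A n) \<le> ennreal (real (Suc n)) * (\<integral>\<^sup>+y. ennreal \<bar>h y\<bar> \<partial>N)"
    proof -
      have "emeasure N (?A n) = (\<integral>\<^sup>+y. indicator (?A n) y \<partial>N)" by simp
      also have "\<dots> \<le> (\<integral>\<^sup>+y. ennreal (real (Suc n)) * ennreal \<bar>h y\<bar> \<partial>N)"
      proof (intro nn_integral_mono)
        fix y
        have "1 \<le> real (Suc n) * \<bar>h y\<bar>" if "y \<in> ?A n"
        proof -
          have "1 \<le> real (Suc n) * h y" using that by (simp add: divide_le_eq mult.commute)
          also have "\<dots> \<le> real (Suc n) * \<bar>h y\<bar>" by (intro mult_left_mono) auto
          finally show ?thesis .
        qed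
        then show "indicator (?A n) y \<le> ennreal (real (Suc n)) * ennreal \<bar>h y\<bar>"
          by (auto simp del: of_nat_Suc simp: indicator_def simp flip: ennreal_mult' ennreal_1 intro!: ennreal_leI)
      qed
      also have "\<dots> = ennreal (real (Suc n)) * (\<integral>\<^sup>+y. ennreal \<bar>h y\<bar> \<partial>N)"
        by (rule nn_integral_cmult) simp
      finally show ?thesis .
    qed
    moreover have "\<dots> < \<infinity>"
      using assms(1) by (auto simp: integrable_iff_bounded ennreal_mult_less_top)
    ultimately show False using * by simp
  qed
qed

section \<open>One Levy triplet: integrability, and evaluation of the symbol integral\<close>

context
  fixes b :: "real ^ 'n" and Q :: "real ^ 'n ^ 'n" and N :: "(real ^ 'n) measure"
  assumes triplet: "levy_triplet b Q N"
begin

text \<open>\<open>N\<close> lives on the nonzero vectors; composing with this inclusion makes Borel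
  functions on the whole space measurable for \<open>N\<close>.\<close>

lemma levy_measurable_ident: "(\<lambda>y. y) \<in> N \<rightarrow>\<^sub>M borel"
proof -
  have "sets N = sets (restrict_space borel (- {0}))" using triplet by (simp add: levy_triplet_def)
  then show ?thesis by (simp cong: measurable_cong_sets add: measurable_restrict_space1)
qed

lemma levy_space: "space N = - {0}"
  using triplet sets_eq_imp_space_eq[of N "restrict_space borel (- {0})"]
  by (simp add: levy_triplet_def space_restrict_space)

lemma levy_integrable: "integrable N (\<lambda>y. min ((norm y)\<^sup>2) 1)"
proof (rule integrableI_bounded)
  show "(\<lambda>y. min ((norm y)\<^sup>2) 1) \<in> borel_measurable N"
    by (rule measurable_compose[OF levy_measurable_ident]) measurable
  show "(\<integral>\<^sup>+ y. ennreal (norm (min ((norm y)\<^sup>2) 1)) \<partial>N) < \<infinity>"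
    using triplet by (simp add: levy_triplet_def)
qed

lemma levy_sigma_finite: "sigma_finite_measure N"
  by (rule sigma_finite_measure_integrable_pos[OF levy_integrable]) (auto simp: levy_space)

text \<open>Outside the ball either \<open>min ((norm y)\<^sup>2) 1\<close> is 1, or it is the
  squared norm and at least r^2; the factor 1 + 1/r^2 covers both cases.\<close>

lemma levy_tail_integrable:
  assumes "0 < r" shows "integrable N (indicator (- ball 0 r) :: _ \<Rightarrow> real)"
proof (rule Bochner_Integration.integrable_bound)
  show "integrable N (\<lambda>y. (1 + 1 / r\<^sup>2) * min ((norm y)\<^sup>2) 1)" using levy_integrable by simp
  show "(indicator (- ball 0 r) :: _ \<Rightarrow> real) \<in> borel_measurable N"
    by (rule measurable_compose[OF levy_measurable_ident]) measurable
  show "AE y in N. norm (indicator (- ball 0 r) y :: real) \<le> norm ((1 + 1 / r\<^sup>2) * min ((norm y)\<^sup>2) 1)"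
  proof (rule AE_I2)
    fix y :: "real ^ 'n"
    have "1 \<le> (1 + 1 / r\<^sup>2) * min ((norm y)\<^sup>2) 1" if "r \<le> norm y"
    proof (cases "(norm y)\<^sup>2 \<le> 1")
      case True
      have "1 \<le> 1 / r\<^sup>2 * (norm y)\<^sup>2" using that assms by (simp add: field_simps power_mono)
      also have "\<dots> \<le> (1 + 1 / r\<^sup>2) * (norm y)\<^sup>2" by (intro mult_right_mono) auto
      finally show ?thesis using True by (simp add: min_def)
    qed (simp add: min_def)
    then show "norm (indicator (- ball 0 r) y :: real) \<le> norm ((1 + 1 / r\<^sup>2) * min ((norm y)\<^sup>2) 1)"
      by (auto simp: indicator_def intro: order_trans[OF _ abs_ge_self])
  qed
qed

text \<open>For short \<open>y\<close> the compensator cancels the linear Taylor term and a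
  quadratic remainder is left; for long \<open>y\<close> the crude bound 2 suffices. The majorant
  splits into a function of \<xi> and one of \<open>y\<close>, as \<open>Fubini_dominated\<close>
  demands.\<close>

lemma levy_integrand_bound:
  "norm (1 - iexp (y \<bullet> \<xi>) + \<i> * of_real (y \<bullet> \<xi>) * indicator {0<..<1} (norm y))
    \<le> 2 * (1 + (norm \<xi>)\<^sup>2) * min ((norm y)\<^sup>2) 1"
proof (cases "y = 0 \<or> 1 \<le> norm y")
  case True
  have "norm (1 - iexp (y \<bullet> \<xi>)) \<le> 2" by (rule order_trans[OF norm_triangle_ineq4]) simp
  also have "\<dots> \<le> 2 * (1 + (norm \<xi>)\<^sup>2)" by simp
  finally have "norm (1 - iexp (y \<bullet> \<xi>)) \<le> 2 * (1 + (norm \<xi>)\<^sup>2)" .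
  moreover have "min ((norm y)\<^sup>2) 1 = 1" if "y \<noteq> 0" using True that by (simp add: min_absorb2)
  ultimately show ?thesis using True by (cases "y = 0") auto
next
  case False
  let ?a = "y \<bullet> \<xi>"
  have "norm (iexp ?a - (1 + \<i> * of_real ?a)) \<le> ?a\<^sup>2 / 2"
    using iexp_approx1[of ?a 1] by (simp add: power2_eq_square)
  also have "\<dots> \<le> ?a\<^sup>2" by simp
  also have "\<dots> \<le> (norm y * norm \<xi>)\<^sup>2"
    using Cauchy_Schwarz_ineq2[of y \<xi>] by (simp add: abs_mult flip: abs_le_square_iff)
  also have "\<dots> \<le> 2 * (1 + (norm \<xi>)\<^sup>2) * (norm y)\<^sup>2" by (simp add: power_mult_distrib algebra_simps)
  also have "(norm y)\<^sup>2 = min ((norm y)\<^sup>2) 1" using False by (simp add: min_def power_le_one)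
  finally have "norm (iexp ?a - (1 + \<i> * of_real ?a)) \<le> 2 * (1 + (norm \<xi>)\<^sup>2) * min ((norm y)\<^sup>2) 1" .
  moreover have "norm (1 - iexp ?a + \<i> * of_real ?a) = norm (iexp ?a - (1 + \<i> * of_real ?a))"
    by (subst norm_minus_commute) (simp add: algebra_simps)
  ultimately show ?thesis using False by simp
qed

text \<open>Drift and diffusion are moments that vanish. In the jump part, Fubini puts the
  \<xi>-integral inside, where inversion yields w(x) - w(x+y) plus a multiple of a first moment;
  since w(x) = 0, only -w(x+y) survives.\<close>

lemma symbol_integral_eq_levy_integral:
  assumes wG: "fourier_pair w G" and "0 < \<delta>" and w: "\<And>y. y \<in> ball x \<delta> \<Longrightarrow> w y = 0"
  shows "(\<integral>\<xi>. iexp (x \<bullet> \<xi>) * (- \<i> * of_real (b \<bullet> \<xi>) + 1 / 2 * of_real (\<xi> \<bullet> (Q *v \<xi>))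
      + (\<integral>y. 1 - iexp (y \<bullet> \<xi>) + \<i> * of_real (y \<bullet> \<xi>) * indicator {0<..<1} (norm y) \<partial>N)) * G \<xi> \<partial>lborel)
    = - of_real (\<integral>y. w (x + y) \<partial>N)"
proof -
  let ?c = "\<lambda>y \<xi>. 1 - iexp (y \<bullet> \<xi>) + \<i> * of_real (y \<bullet> \<xi>) * indicator {0<..<1} (norm y)"
  have G[measurable]: "G \<in> borel_measurable borel" using wG by (simp add: fourier_pair_def)
  have int: "integrable lborel (\<lambda>\<xi>. (1 + (norm \<xi>)\<^sup>2) * norm (G \<xi>))" using wG by (simp add: fourier_pair_def)
  note moments = fourier_pair_moments_zero[OF wG \<open>0 < \<delta>\<close>, of x, OF w]
  have int_quad: "integrable lborel (\<lambda>\<xi>. iexp (x \<bullet> \<xi>) * (of_real (u \<bullet> \<xi>) * (of_real (v \<bullet> \<xi>) * G \<xi>)))" for u v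
  proof (rule Bochner_Integration.integrable_bound)
    show "integrable lborel (\<lambda>\<xi>. norm u * norm v * ((1 + (norm \<xi>)\<^sup>2) * norm (G \<xi>)))" using int by simp
    have "\<bar>u \<bullet> \<xi>\<bar> * \<bar>v \<bullet> \<xi>\<bar> \<le> norm u * norm v * (1 + (norm \<xi>)\<^sup>2)" for \<xi>
    proof -
      have "\<bar>u \<bullet> \<xi>\<bar> * \<bar>v \<bullet> \<xi>\<bar> \<le> (norm u * norm \<xi>) * (norm v * norm \<xi>)"
        by (intro mult_mono Cauchy_Schwarz_ineq2) auto
      also have "\<dots> \<le> norm u * norm v * (1 + (norm \<xi>)\<^sup>2)" by (simp add: algebra_simps power2_eq_square)
      finally show ?thesis .
    qed
    then show "AE \<xi> in lborel. norm (iexp (x \<bullet> \<xi>) * (of_real (u \<bullet> \<xi>) * (of_real (v \<bullet> \<xi>) * G \<xi>)))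
        \<le> norm (norm u * norm v * ((1 + (norm \<xi>)\<^sup>2) * norm (G \<xi>)))"
      by (auto intro!: AE_I2 mult_right_mono simp: norm_mult abs_mult simp flip: mult.assoc)
  qed measurable
  have int_lin: "integrable lborel (\<lambda>\<xi>. iexp (x \<bullet> \<xi>) * (of_real (v \<bullet> \<xi>) * G \<xi>))" for v
  proof (rule Bochner_Integration.integrable_bound)
    show "integrable lborel (\<lambda>\<xi>. norm v * ((1 + (norm \<xi>)\<^sup>2) * norm (G \<xi>)))" using int by simp
    have "\<bar>v \<bullet> \<xi>\<bar> \<le> norm v * (1 + (norm \<xi>)\<^sup>2)" for \<xi>
    proof -
      have "norm \<xi> \<le> 1 + (norm \<xi>)\<^sup>2"
        using sum_squares_ge_zero[of "norm \<xi> - 1" "norm \<xi>"] by (simp add: power2_eq_square algebra_simps)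
      then show ?thesis using Cauchy_Schwarz_ineq2[of v \<xi>] by (meson mult_left_mono norm_ge_zero order_trans)
    qed
    then show "AE \<xi> in lborel. norm (iexp (x \<bullet> \<xi>) * (of_real (v \<bullet> \<xi>) * G \<xi>))
        \<le> norm (norm v * ((1 + (norm \<xi>)\<^sup>2) * norm (G \<xi>)))"
      by (auto intro!: AE_I2 mult_right_mono simp: norm_mult abs_mult simp flip: mult.assoc)
  qed measurable
  \<comment> \<open>Writing the quadratic form as a sum of products of two linear functionals
    reduces it to second moments.\<close>
  have quad: "\<xi> \<bullet> (Q *v \<xi>) = (\<Sum>i\<in>UNIV. (axis i 1 \<bullet> \<xi>) * (Q $ i \<bullet> \<xi>))" for \<xi>
    by (simp add: inner_vec_def[of \<xi>] matrix_vector_mult_def inner_axis' inner_vec_def[of "Q $ _"])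
  have 1: "integrable lborel (\<lambda>\<xi>. iexp (x \<bullet> \<xi>) * (of_real (\<xi> \<bullet> (Q *v \<xi>)) * G \<xi>))"
    "(\<integral>\<xi>. iexp (x \<bullet> \<xi>) * (of_real (\<xi> \<bullet> (Q *v \<xi>)) * G \<xi>) \<partial>lborel) = 0"
  proof -
    have eq: "iexp (x \<bullet> \<xi>) * (of_real (\<xi> \<bullet> (Q *v \<xi>)) * G \<xi>) =
      (\<Sum>i\<in>UNIV. iexp (x \<bullet> \<xi>) * (of_real (axis i 1 \<bullet> \<xi>) * (of_real (Q $ i \<bullet> \<xi>) * G \<xi>)))" for \<xi>
      unfolding quad by (simp add: sum_distrib_left sum_distrib_right mult_ac)
    show "integrable lborel (\<lambda>\<xi>. iexp (x \<bullet> \<xi>) * (of_real (\<xi> \<bullet> (Q *v \<xi>)) * G \<xi>))"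
      unfolding eq by (intro Bochner_Integration.integrable_sum int_quad)
    show "(\<integral>\<xi>. iexp (x \<bullet> \<xi>) * (of_real (\<xi> \<bullet> (Q *v \<xi>)) * G \<xi>) \<partial>lborel) = 0"
      unfolding eq by (subst Bochner_Integration.integral_sum) (auto intro: int_quad simp only: moments(2) sum.neutral_const)
  qed
  have m[measurable]: "(\<lambda>p. fst p) \<in> borel_measurable (lborel \<Otimes>\<^sub>M N)" "(\<lambda>p. snd p) \<in> borel_measurable (lborel \<Otimes>\<^sub>M N)"
    using measurable_compose[OF measurable_snd levy_measurable_ident] by auto
  let ?f = "\<lambda>\<xi> y. iexp (x \<bullet> \<xi>) * G \<xi> * ?c y \<xi>"
  have Fubini: "integrable lborel (\<lambda>\<xi>. \<integral>y. ?f \<xi> y \<partial>N)"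
    "(\<integral>\<xi>. (\<integral>y. ?f \<xi> y \<partial>N) \<partial>lborel) = (\<integral>y. (\<integral>\<xi>. ?f \<xi> y \<partial>lborel) \<partial>N)"
  proof (rule_tac [!] Fubini_dominated[where g = "\<lambda>\<xi>. 2 * ((1 + (norm \<xi>)\<^sup>2) * norm (G \<xi>))"
        and h = "\<lambda>y. min ((norm y)\<^sup>2) 1"])
    show "(\<lambda>(\<xi>, y). ?f \<xi> y) \<in> borel_measurable (lborel \<Otimes>\<^sub>M N)"
      "(\<lambda>(\<xi>, y). ?f \<xi> y) \<in> borel_measurable (lborel \<Otimes>\<^sub>M N)"
      unfolding case_prod_beta' by measurable
    show "norm (?f \<xi> y) \<le> 2 * ((1 + (norm \<xi>)\<^sup>2) * norm (G \<xi>)) * min ((norm y)\<^sup>2) 1"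
      "norm (?f \<xi> y) \<le> 2 * ((1 + (norm \<xi>)\<^sup>2) * norm (G \<xi>)) * min ((norm y)\<^sup>2) 1" for \<xi> y
      using mult_left_mono[OF levy_integrand_bound[of y \<xi>] norm_ge_zero[of "G \<xi>"]]
      by (simp_all only: norm_mult norm_exp_i_times mult_1 mult_ac)
  qed (use int levy_integrable levy_sigma_finite in \<open>auto simp: lborel.sigma_finite_measure_axioms\<close>)
  have inner: "(\<integral>\<xi>. ?f \<xi> y \<partial>lborel) = - of_real (w (x + y))" for y
  proof -
    have "?f \<xi> y = iexp (x \<bullet> \<xi>) * G \<xi> - iexp ((x + y) \<bullet> \<xi>) * G \<xi>
        + \<i> * indicator {0<..<1} (norm y) * (iexp (x \<bullet> \<xi>) * (of_real (y \<bullet> \<xi>) * G \<xi>))" for \<xi>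
      by (simp add: inner_add_left distrib_left exp_add algebra_simps)
    then have "(\<integral>\<xi>. ?f \<xi> y \<partial>lborel) =
        (\<integral>\<xi>. iexp (x \<bullet> \<xi>) * G \<xi> \<partial>lborel) - (\<integral>\<xi>. iexp ((x + y) \<bullet> \<xi>) * G \<xi> \<partial>lborel)
        + \<i> * indicator {0<..<1} (norm y) * (\<integral>\<xi>. iexp (x \<bullet> \<xi>) * (of_real (y \<bullet> \<xi>) * G \<xi>) \<partial>lborel)"
      using fourier_pair_integrable_iexp[OF wG] int_lin[of y]
      by (simp only: Bochner_Integration.integral_add Bochner_Integration.integral_diff
          Bochner_Integration.integrable_diff Bochner_Integration.integrable_mult_right integral_mult_right_zero)
    also have "\<dots> = of_real (w x) - of_real (w (x + y))"
      using wG moments(1)[of y] by (simp add: fourier_pair_def)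
    finally show ?thesis using w[of x] \<open>0 < \<delta>\<close> by simp
  qed
  have "iexp (x \<bullet> \<xi>) * (- \<i> * of_real (b \<bullet> \<xi>) + 1 / 2 * of_real (\<xi> \<bullet> (Q *v \<xi>)) + (\<integral>y. ?c y \<xi> \<partial>N)) * G \<xi> =
      - \<i> * (iexp (x \<bullet> \<xi>) * (of_real (b \<bullet> \<xi>) * G \<xi>))
      + 1 / 2 * (iexp (x \<bullet> \<xi>) * (of_real (\<xi> \<bullet> (Q *v \<xi>)) * G \<xi>)) + (\<integral>y. ?f \<xi> y \<partial>N)" for \<xi>
    by (simp only: integral_mult_right_zero) (simp add: algebra_simps)
  then have "(\<integral>\<xi>. iexp (x \<bullet> \<xi>) * (- \<i> * of_real (b \<bullet> \<xi>) + 1 / 2 * of_real (\<xi> \<bullet> (Q *v \<xi>)) + (\<integral>y. ?c y \<xi> \<partial>N)) * G \<xi> \<partial>lborel) =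
      - \<i> * (\<integral>\<xi>. iexp (x \<bullet> \<xi>) * (of_real (b \<bullet> \<xi>) * G \<xi>) \<partial>lborel)
      + 1 / 2 * (\<integral>\<xi>. iexp (x \<bullet> \<xi>) * (of_real (\<xi> \<bullet> (Q *v \<xi>)) * G \<xi>) \<partial>lborel)
      + (\<integral>\<xi>. (\<integral>y. ?f \<xi> y \<partial>N) \<partial>lborel)"
    using int_lin[of b] 1(1) Fubini(1)
    by (simp only: Bochner_Integration.integral_add Bochner_Integration.integrable_add
          Bochner_Integration.integrable_mult_right integral_mult_right_zero)
  also have "\<dots> = (\<integral>y. - complex_of_real (w (x + y)) \<partial>N)"
    by (simp only: moments(1) 1(2) Fubini(2) inner) simp
  finally show ?thesis by simp
qed

end

section \<open>Uniform approximation away from a point\<close>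

text \<open>A bump on a cube: positive exactly on the open cube of half-width \<open>r\<close>
  centred at \<open>x\<close>.\<close>

definition cutoff :: "'a::euclidean_space \<Rightarrow> real \<Rightarrow> 'a \<Rightarrow> real" where
  "cutoff x r y = (\<Prod>b\<in>Basis. bump r ((y - x) \<bullet> b))"

lemma cutoff_tensor_test: "cutoff x r \<in> tensor_test"
proof -
  have "(\<lambda>y. \<Prod>b\<in>Basis. bump r (y \<bullet> b - x \<bullet> b)) \<in> tensor_test"
    by (intro tensor_test.prod test_fun_bump)
  then show ?thesis by (simp add: cutoff_def[abs_def] inner_diff_left)
qed

lemma cutoff_nonneg: "0 \<le> cutoff x r y"
  and cutoff_le_1: "cutoff x r y \<le> 1"
  by (auto simp: cutoff_def bump_nonneg bump_le_1 intro!: prod_nonneg prod_le_1)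

lemma cutoff_pos: "norm (y - x) < r \<Longrightarrow> 0 < cutoff x r y"
  unfolding cutoff_def by (intro prod_pos ballI bump_pos) (meson Basis_le_norm le_less_trans)

text \<open>If every coordinate were below \<open>r\<close>, the l1 norm, which bounds the norm,
  would be below \<open>r\<close> times the dimension. This is the source of the dimension factors
  in the radii.\<close>

lemma cutoff_zero:
  fixes x :: "'a::euclidean_space" and r :: real
  assumes "real DIM('a) * r \<le> norm (y - x)" shows "cutoff x r y = 0"
proof -
  have "\<exists>b\<in>Basis. r \<le> \<bar>(y - x) \<bullet> b\<bar>"
  proof (rule ccontr)
    assume "\<not> ?thesis"
    then have "(\<Sum>b\<in>Basis. \<bar>(y - x) \<bullet> b\<bar>) < (\<Sum>b\<in>(Basis::'a set). r)"
      by (intro sum_strict_mono) (auto simp: not_le)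
    with norm_le_l1[of "y - x"] assms show False by simp
  qed
  then show ?thesis unfolding cutoff_def by (auto intro!: prod_zero bump_zero)
qed

lemma cutoff_le_center: "0 < r \<Longrightarrow> cutoff x r y \<le> cutoff x r x"
  unfolding cutoff_def by (intro prod_mono) (simp add: bump_nonneg bump_le_bump_0)

text \<open>Polynomials times this weight stay in \<open>tensor_test\<close>, so a function supported where the weight is
  positive is approximated by approximating its quotient by the weight.\<close>

definition annulus :: "'a::euclidean_space \<Rightarrow> real \<Rightarrow> real \<Rightarrow> 'a \<Rightarrow> real" where
  "annulus x r R y = (\<Sum>b\<in>Basis. (flat_exp ((y - x) \<bullet> b - r) + flat_exp (- ((y - x) \<bullet> b) - r)) * cutoff x R y)"

lemma annulus_tensor_test: "annulus x r R \<in> tensor_test"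
proof -
  have "smooth (\<lambda>s. flat_exp (1 * s + (- c - r)) + flat_exp (- 1 * s + (c - r)))" for c
    by (intro smooth_add smooth_affine_compose smooth_flat_exp)
  from tensor_test_mult_component[OF cutoff_tensor_test[of x R] this]
  have "(\<lambda>y. \<Sum>b\<in>Basis. (flat_exp (1 * (y \<bullet> b) + (- (x \<bullet> b) - r)) + flat_exp (- 1 * (y \<bullet> b) + (x \<bullet> b - r)))
      * cutoff x R y) \<in> tensor_test"
    by (intro tensor_test_sum) auto
  then show ?thesis by (simp add: annulus_def[abs_def] inner_diff_left algebra_simps)
qed

lemma annulus_nonneg: "0 \<le> annulus x r R y"
  unfolding annulus_def by (intro sum_nonneg mult_nonneg_nonneg add_nonneg_nonneg flat_exp_nonneg cutoff_nonneg)

lemma annulus_le: "annulus x r R (y::'a::euclidean_space) \<le> 2 * real DIM('a)"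
proof -
  have "(flat_exp s + flat_exp t) * cutoff x R y \<le> 2 * 1" for s t
    using flat_exp_le_1[of s] flat_exp_le_1[of t]
    by (intro mult_mono) (auto simp: cutoff_le_1 cutoff_nonneg flat_exp_nonneg)
  then have "annulus x r R y \<le> (\<Sum>b\<in>(Basis::'a set). 2 * 1)"
    unfolding annulus_def by (intro sum_mono)
  then show ?thesis by simp
qed

lemma annulus_zero_near: "norm (y - x) \<le> r \<Longrightarrow> annulus x r R y = 0"
proof -
  assume *: "norm (y - x) \<le> r"
  have "\<bar>(y - x) \<bullet> b\<bar> \<le> r" if "b \<in> Basis" for b using Basis_le_norm[OF that, of "y - x"] * by linarith
  then show ?thesis unfolding annulus_def by (intro sum.neutral) (auto simp: flat_exp_zero abs_le_iff)
qed

lemma annulus_zero_far: "real DIM('a) * R \<le> norm (y - x) \<Longrightarrow> annulus x r R (y::'a::euclidean_space) = 0"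
  by (simp add: annulus_def cutoff_zero)

text \<open>Again by comparison with the l1 norm, some coordinate of y - x exceeds \<open>r\<close>,
  and one of its two one-sided terms is then positive.\<close>

lemma annulus_pos:
  fixes x :: "'a::euclidean_space" and r R :: real
  assumes "real DIM('a) * r < norm (y - x)" "norm (y - x) < R"
  shows "0 < annulus x r R y"
proof -
  have "\<exists>b\<in>Basis. r < \<bar>(y - x) \<bullet> b\<bar>"
  proof (rule ccontr)
    assume "\<not> ?thesis"
    then have "(\<Sum>b\<in>Basis. \<bar>(y - x) \<bullet> b\<bar>) \<le> (\<Sum>b\<in>(Basis::'a set). r)"
      by (intro sum_mono) (auto simp: not_less)
    with norm_le_l1[of "y - x"] assms show False by simp
  qed
  then obtain b where b: "b \<in> Basis" "r < \<bar>(y - x) \<bullet> b\<bar>" by blast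
  have "0 < flat_exp ((y - x) \<bullet> b - r) + flat_exp (- ((y - x) \<bullet> b) - r)"
  proof (cases "r < (y - x) \<bullet> b")
    case True
    then show ?thesis by (intro add_pos_nonneg flat_exp_pos flat_exp_nonneg) simp
  next
    case False
    with b show ?thesis by (intro add_nonneg_pos flat_exp_pos flat_exp_nonneg) linarith
  qed
  with b(1) cutoff_pos[OF assms(2)] show ?thesis
    unfolding annulus_def
    by (intro sum_pos2[OF finite_Basis b(1)] mult_pos_pos mult_nonneg_nonneg add_nonneg_nonneg
        flat_exp_nonneg cutoff_nonneg) auto
qed

text \<open>Dividing \<open>F\<close> itself by the weight fails where the weight vanishes.
  Truncating small values first, at cost \<open>e\<close>, leaves a function that is nonzero only
  where the weight is positive. Its quotient is continuous, is approximated by a polynomial on a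
  ball, and is multiplied back.\<close>

lemma tensor_test_approx:
  fixes F :: "'a::euclidean_space \<Rightarrow> real"
  assumes F: "continuous_on UNIV F" and lim: "(F \<longlongrightarrow> 0) at_infinity"
    and "0 < \<delta>" and F0: "\<And>y. y \<in> ball x \<delta> \<Longrightarrow> F y = 0" and "0 < \<epsilon>"
  obtains w where "w \<in> tensor_test" "\<And>y. \<bar>F y - w y\<bar> < \<epsilon>"
    "\<And>y. norm (y - x) \<le> \<delta> / (2 * real DIM('a)) \<Longrightarrow> w y = 0"
proof -
  define e where "e = \<epsilon> / 2"
  have e: "0 < e" using \<open>0 < \<epsilon>\<close> by (simp add: e_def)
  \<comment> \<open>Soft thresholding: values are moved towards 0 by \<open>e\<close>, and those of
    size at most \<open>e\<close> become 0, with continuity preserved.\<close>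
  define F' where "F' y = F y - max (- e) (min e (F y))" for y
  have F'_cont: "continuous_on UNIV F'"
    unfolding F'_def by (intro continuous_intros F)
  have F'_close: "\<bar>F y - F' y\<bar> \<le> e" for y using e by (auto simp: F'_def)
  have F'_zero: "F' y = 0" if "\<bar>F y\<bar> \<le> e" for y using that e by (auto simp: F'_def)
  obtain B where B: "\<And>y. B \<le> norm y \<Longrightarrow> \<bar>F y\<bar> < e"
    using tendstoD[OF lim e] by (auto simp: eventually_at_infinity dist_real_def)
  \<comment> \<open>Large enough that all points where the modulus of \<open>F\<close> is at least
    \<open>e\<close> lie within distance \<open>R\<close> of \<open>x\<close>.\<close>
  define R where "R = \<bar>B\<bar> + norm x + \<delta> + 1"
  \<comment> \<open>Then \<open>r\<close> times the dimension is \<delta>/2, so the weight is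
    positive at distances from \<delta> up to \<open>R\<close>, while it vanishes up to distance
    \<open>r\<close>.\<close>
  define r where "r = \<delta> / (2 * real DIM('a))"
  have r: "real DIM('a) * r < \<delta>" using \<open>0 < \<delta>\<close> by (simp add: r_def)
  let ?\<chi> = "annulus x r R"
  define K where "K = {y. e \<le> \<bar>F y\<bar>}"
  have K_pos: "0 < ?\<chi> y" if "y \<in> K" for y
  proof (rule annulus_pos)
    have "F y \<noteq> 0" using that e by (auto simp: K_def)
    then have "y \<notin> ball x \<delta>" using F0 by blast
    then have "\<delta> \<le> norm (y - x)" by (simp add: dist_norm norm_minus_commute)
    with r show "real DIM('a) * r < norm (y - x)" by linarith
    have "norm y < B" using that B[of y] by (force simp: K_def)
    then show "norm (y - x) < R" using norm_triangle_ineq4[of y x] \<open>0 < \<delta>\<close> by (simp add: R_def)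
  qed
  have \<chi>_cont: "continuous_on S ?\<chi>" for S by (rule tensor_test_continuous_on[OF annulus_tensor_test])
  have "continuous_on ({y. 0 < ?\<chi> y} \<union> - K) (\<lambda>y. F' y / ?\<chi> y)"
  proof (rule continuous_on_open_Un)
    show "open {y. 0 < ?\<chi> y}" by (intro open_Collect_less \<chi>_cont continuous_intros)
    show "open (- K)" unfolding K_def by (intro open_Compl closed_Collect_le continuous_intros F)
    show "continuous_on {y. 0 < ?\<chi> y} (\<lambda>y. F' y / ?\<chi> y)"
      by (intro continuous_intros \<chi>_cont continuous_on_subset[OF F'_cont]) auto
    \<comment> \<open>Off \<open>K\<close> the numerator is 0, so the quotient is 0 even where the
      weight vanishes, since 0/0 is 0. Two open sets on which the quotient is continuous therefore
      cover the space.\<close>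
    have "F' y / ?\<chi> y = 0" if "y \<in> - K" for y using that by (simp add: K_def F'_zero)
    then show "continuous_on (- K) (\<lambda>y. F' y / ?\<chi> y)"
      by (subst continuous_on_cong[OF refl, of _ _ "\<lambda>_. 0"]) auto
  qed
  moreover have "{y. 0 < ?\<chi> y} \<union> - K = UNIV" using K_pos by auto
  ultimately have "continuous_on UNIV (\<lambda>y. F' y / ?\<chi> y)" by simp
  then have "continuous_on (cball x (real DIM('a) * R)) (\<lambda>y. F' y / ?\<chi> y)" by (rule continuous_on_subset) simp
  \<comment> \<open>The weight is at most twice the dimension, so multiplying back by it turns this
    accuracy into \<open>e\<close>.\<close>
  moreover have "0 < e / (2 * real DIM('a))" using e by simp
  ultimately obtain p where p: "real_polynomial_function p"
    "\<And>y. y \<in> cball x (real DIM('a) * R) \<Longrightarrow> \<bar>F' y / ?\<chi> y - p y\<bar> < e / (2 * real DIM('a))"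
    using Stone_Weierstrass_real_polynomial_function[OF compact_cball] by blast
  show ?thesis
  proof (rule that)
    show "(\<lambda>y. p y * ?\<chi> y) \<in> tensor_test"
      by (rule tensor_test_mult_real_polynomial_function[OF p(1) annulus_tensor_test])
    show "p y * ?\<chi> y = 0" if "norm (y - x) \<le> \<delta> / (2 * real DIM('a))" for y
      using that by (simp add: annulus_zero_near r_def)
    have F'_approx: "\<bar>F' y - p y * ?\<chi> y\<bar> < e" for y
    proof (cases "?\<chi> y = 0")
      case True
      then have "y \<notin> K" using K_pos[of y] by auto
      then show ?thesis using True e by (simp add: K_def F'_zero)
    next
      case False
      then have pos: "0 < ?\<chi> y" using annulus_nonneg[of x r R y] by simp
      have y: "y \<in> cball x (real DIM('a) * R)"
        using annulus_zero_far[of R y x r] False by (force simp: dist_norm norm_minus_commute)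
      have "\<bar>F' y - p y * ?\<chi> y\<bar> = \<bar>F' y / ?\<chi> y - p y\<bar> * ?\<chi> y"
        using pos by (simp add: abs_mult_pos left_diff_distrib)
      also have "\<dots> < e / (2 * real DIM('a)) * ?\<chi> y"
        by (rule mult_strict_right_mono[OF p(2)[OF y] pos])
      also have "\<dots> \<le> e / (2 * real DIM('a)) * (2 * real DIM('a))"
        using e annulus_le[of x r R y] by (intro mult_left_mono) auto
      finally show ?thesis by simp
    qed
    show "\<bar>F y - p y * ?\<chi> y\<bar> < \<epsilon>" for y
      using F'_close[of y] F'_approx[of y] unfolding e_def by linarith
  qed
qed

section \<open>Small-time asymptotics\<close>

lemma C_zero_bounded:
  assumes "f \<in> C_zero" obtains B where "\<And>y. \<bar>f y\<bar> \<le> B"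
proof -
  from assms have f: "continuous_on UNIV f" "(f \<longlongrightarrow> 0) at_infinity" by (auto simp: C_zero_def)
  obtain R where R: "\<And>y. R \<le> norm y \<Longrightarrow> \<bar>f y\<bar> < 1"
    using tendstoD[OF f(2), of 1] by (auto simp: eventually_at_infinity dist_real_def)
  have "compact (f ` cball 0 R)"
    by (rule compact_continuous_image[OF continuous_on_subset[OF f(1)]]) auto
  then obtain C where C: "\<And>y. norm y \<le> R \<Longrightarrow> \<bar>f y\<bar> \<le> C"
    by (force dest!: compact_imp_bounded simp: bounded_iff)
  have "\<bar>f y\<bar> \<le> max 1 C" for y
    using R[of y] C[of y] by (cases "norm y \<le> R") auto
  then show ?thesis using that by blast
qed

text \<open>Uniform limits are pointwise limits, and uniqueness of the latter justifies the definite
  description in \<open>generator\<close>.\<close>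

lemma generator_tendsto:
  assumes "f \<in> gen_domain T"
  shows "((\<lambda>t. (T t f x - f x) / t) \<longlongrightarrow> generator T f x) (at_right 0)"
proof -
  obtain g where g: "g \<in> C_zero" "uniform_limit UNIV (\<lambda>t x. (T t f x - f x) / t) g (at_right 0)"
    using assms by (auto simp: gen_domain_def)
  have "generator T f = g"
    unfolding generator_def
  proof (rule the_equality)
    fix h assume "h \<in> C_zero \<and> uniform_limit UNIV (\<lambda>t x. (T t f x - f x) / t) h (at_right 0)"
    then have "((\<lambda>t. (T t f y - f y) / t) \<longlongrightarrow> h y) (at_right 0)" for y
      by (auto intro: tendsto_uniform_limitI[OF _ UNIV_I])
    then show "h = g"
      using tendsto_unique[OF trivial_limit_at_right_real _ tendsto_uniform_limitI[OF g(2) UNIV_I]] by blast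
  qed (use g in blast)
  with tendsto_uniform_limitI[OF g(2)] show ?thesis by simp
qed

text \<open>An interchange of limits: \<open>h\<close> and \<open>c\<close> may vary with the
  accuracy \<open>e\<close>, while \<open>M\<close> and \<open>K\<close> are fixed, so both errors
  shrink with \<open>e\<close>.\<close>

lemma tendsto_by_approximation:
  fixes g :: "'a \<Rightarrow> real"
  assumes "\<And>e. 0 < e \<Longrightarrow> \<exists>h c. (h \<longlongrightarrow> c) F \<and> (\<forall>\<^sub>F t in F. \<bar>g t - h t\<bar> \<le> e * M) \<and> \<bar>c - l\<bar> \<le> e * K"
  shows "(g \<longlongrightarrow> l) F"
proof (rule tendstoI)
  fix e :: real assume e: "0 < e"
  \<comment> \<open>Absolute values cover either sign of \<open>M\<close> and \<open>K\<close>; the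
    1 makes \<open>S\<close> positive, so that dividing by it is possible.\<close>
  define S where "S = \<bar>M\<bar> + \<bar>K\<bar> + 1"
  have S: "0 < S" by (simp add: S_def)
  define d where "d = e / (2 * S)"
  have d: "0 < d" using e S by (simp add: d_def)
  obtain h c where h: "(h \<longlongrightarrow> c) F" "\<forall>\<^sub>F t in F. \<bar>g t - h t\<bar> \<le> d * M" "\<bar>c - l\<bar> \<le> d * K"
    using assms[OF d] by blast
  have "d * M + d * K \<le> d * S"
    using d by (simp add: S_def flip: distrib_left)
  also have "\<dots> = e / 2" using S by (simp add: d_def)
  finally have dMK: "d * M + d * K \<le> e / 2" .
  have "\<forall>\<^sub>F t in F. dist (h t) c < e / 2" using e by (intro tendstoD[OF h(1)]) simp
  with h(2) show "\<forall>\<^sub>F t in F. dist (g t) l < e"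
  proof eventually_elim
    case (elim t)
    with h(3) dMK show ?case unfolding dist_real_def by linarith
  qed
qed

lemma small_time_limit_tensor_test:
  fixes P :: "real ^ 'n \<Rightarrow> 'w measure"
  assumes "rich P X" "symbol P X q" "characteristics q b Q \<nu>" "\<forall>x. q x 0 = 0"
    and w: "w \<in> tensor_test" and "0 < \<delta>" and w0: "\<And>y. y \<in> ball x \<delta> \<Longrightarrow> w y = 0"
  shows "((\<lambda>t. (\<integral>\<omega>. w (X t \<omega>) \<partial>P x) / t) \<longlongrightarrow> (\<integral>y. w (x + y) \<partial>\<nu> x)) (at_right 0)"
proof -
  let ?T = "transition_semigroup P X"
  have "w \<in> C_c_infinity" using w tensor_test_subset_C_c_infinity by blast
  then have "complex_of_real (generator ?T w x)
      = - (\<integral>\<xi>. iexp (x \<bullet> \<xi>) * q x \<xi> * fourier w \<xi> \<partial>lborel)"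
    using assms(2) by (simp add: symbol_def)
  also have "\<dots> = of_real (\<integral>y. w (x + y) \<partial>\<nu> x)"
  proof -
    have "levy_triplet (b x) (Q x) (\<nu> x)" and q: "q x \<xi> =
      - \<i> * of_real (b x \<bullet> \<xi>) + 1 / 2 * of_real (\<xi> \<bullet> (Q x *v \<xi>))
      + (\<integral>y. 1 - iexp (y \<bullet> \<xi>) + \<i> * of_real (y \<bullet> \<xi>) * indicator {0<..<1} (norm y) \<partial>\<nu> x)" for \<xi>
      using assms(3,4) unfolding characteristics_def by (blast, simp)
    from symbol_integral_eq_levy_integral[OF this(1) tensor_test_fourier_pair[OF w] \<open>0 < \<delta>\<close> w0]
    show ?thesis by (simp only: q) simp
  qed
  finally have "generator ?T w x = (\<integral>y. w (x + y) \<partial>\<nu> x)" by (simp only: of_real_eq_iff)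
  moreover have "w \<in> gen_domain ?T"
    using assms(1) \<open>w \<in> C_c_infinity\<close> by (auto simp: rich_def)
  from generator_tendsto[OF this, of x]
  \<comment> \<open>The subtracted term of the difference quotient is w(x) = 0.\<close>
  have "((\<lambda>t. (\<integral>\<omega>. w (X t \<omega>) \<partial>P x) / t) \<longlongrightarrow> generator ?T w x) (at_right 0)"
    using w0[of x] \<open>0 < \<delta>\<close> by (simp add: transition_semigroup_def)
  ultimately show ?thesis by simp
qed

theorem corollary4p3:
  fixes P :: "real ^ 'n \<Rightarrow> 'w measure"
    and X :: "real \<Rightarrow> 'w \<Rightarrow> real ^ 'n"
    and q :: "real ^ 'n \<Rightarrow> real ^ 'n \<Rightarrow> complex"
    and b :: "real ^ 'n \<Rightarrow> real ^ 'n"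
    and Q :: "real ^ 'n \<Rightarrow> real ^ 'n ^ 'n"
    and \<nu> :: "real ^ 'n \<Rightarrow> (real ^ 'n) measure"
    and f :: "real ^ 'n \<Rightarrow> real"
  assumes "levy_type_process P X"
    and "rich P X"
    and "symbol P X q"
    and "characteristics q b Q \<nu>"
    and "\<forall>x. q x 0 = 0"
    and "f \<in> C_zero"
    and "\<exists>\<delta>>0. \<forall>y\<in>ball 0 \<delta>. f y = 0"
  shows "\<forall>x. ((\<lambda>t. 1 / t * (\<integral>w. f (X t w - x) \<partial>P x)) \<longlongrightarrow> (\<integral>y. f y \<partial>\<nu> x)) (at_right 0)"
proof
  fix x :: "real ^ 'n"
  let ?D = "real DIM(real ^ 'n)" and ?T = "transition_semigroup P X"
  obtain \<delta> where \<delta>: "0 < \<delta>" and f0: "\<And>y. y \<in> ball 0 \<delta> \<Longrightarrow> f y = 0" using assms(7) by blast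
  have D: "1 \<le> ?D" using DIM_positive[where 'a = "real ^ 'n"] by linarith
  \<comment> \<open>The radius on which \<open>tensor_test_approx\<close> makes the approximant
    vanish; it is below \<delta>, so the shifted \<open>f\<close> vanishes there too.\<close>
  define \<rho> where "\<rho> = \<delta> / (2 * ?D)"
  have \<rho>: "0 < \<rho>" "\<rho> < \<delta>"
  proof -
    show "0 < \<rho>" using \<delta> D by (simp add: \<rho>_def)
    have "1 < 2 * ?D" using D by linarith
    from mult_strict_left_mono[OF this \<delta>] show "\<rho> < \<delta>"
      unfolding \<rho>_def using D by (subst pos_divide_less_eq) auto
  qed
  have f: "continuous_on UNIV f" "(f \<longlongrightarrow> 0) at_infinity" using assms(6) by (auto simp: C_zero_def)
  have f_meas: "f \<in> borel_measurable borel" by (rule borel_measurable_continuous_onI[OF f(1)])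

  interpret Px: prob_space "P x"
    using assms(1) by (auto simp: levy_type_process_def markov_process_def)
  have X_meas: "X t \<in> borel_measurable (P x)" if "0 \<le> t" for t
    using assms(1) that by (auto simp: levy_type_process_def markov_process_def)
  have int_P: "integrable (P x) (\<lambda>\<omega>. g (X t \<omega>))"
    if "g \<in> borel_measurable borel" "\<And>y. \<bar>g y\<bar> \<le> B" "0 \<le> t" for g :: "real ^ 'n \<Rightarrow> real" and B t
    using that measurable_compose[OF X_meas that(1)] by (intro Px.integrable_const_bound[of _ B]) auto
  have triplet: "levy_triplet (b x) (Q x) (\<nu> x)" using assms(4) by (simp add: characteristics_def)
  let ?tail = "indicator (- ball 0 \<rho>) :: real ^ 'n \<Rightarrow> real"
  have tail: "integrable (\<nu> x) ?tail" by (rule levy_tail_integrable[OF triplet \<rho>(1)])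
  have int_\<nu>: "integrable (\<nu> x) g"
    if "g \<in> borel_measurable borel" "\<And>y. \<bar>g y\<bar> \<le> B" "\<And>y. norm y < \<rho> \<Longrightarrow> g y = 0"
    for g :: "real ^ 'n \<Rightarrow> real" and B
  proof (rule Bochner_Integration.integrable_bound)
    show "integrable (\<nu> x) (\<lambda>y. B * ?tail y)" using tail by simp
    show "g \<in> borel_measurable (\<nu> x)"
      by (rule measurable_compose[OF levy_measurable_ident[OF triplet] that(1)])
    show "AE y in \<nu> x. norm (g y) \<le> norm (B * ?tail y)"
      using that(2,3) by (auto simp: indicator_def intro: order_trans[OF _ abs_ge_self])
  qed

  \<comment> \<open>Normalised to be 1 at \<open>x\<close>, hence at most 1 everywhere; the
    half-width \<rho>/d, with d the dimension, confines it to the ball of radius \<rho>.\<close>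
  define \<psi> where "\<psi> y = cutoff x (\<rho> / ?D) y / cutoff x (\<rho> / ?D) x" for y
  have c: "0 < cutoff x (\<rho> / ?D) x" by (rule cutoff_pos) (use \<rho> D in simp)
  have \<psi>_test: "\<psi> \<in> tensor_test"
    using tensor_test_scale[OF cutoff_tensor_test, of "1 / cutoff x (\<rho> / ?D) x"] by (simp add: \<psi>_def[abs_def])
  have \<psi>_bounds: "0 \<le> \<psi> y" "\<psi> y \<le> 1" for y
    using c cutoff_nonneg[of x "\<rho> / ?D" y] cutoff_le_center[of "\<rho> / ?D" x y] \<rho> D by (auto simp: \<psi>_def)
  have \<psi>_zero: "\<psi> y = 0" if "\<rho> \<le> norm (y - x)" for y
    unfolding \<psi>_def by (subst cutoff_zero) (use that D in auto)
  have gen: "w \<in> gen_domain ?T" if "w \<in> tensor_test" for w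
    using that tensor_test_subset_C_c_infinity assms(2) by (auto simp: rich_def)
  have w_meas: "w \<in> borel_measurable borel" if "w \<in> tensor_test" for w :: "real ^ 'n \<Rightarrow> real"
    by (rule borel_measurable_continuous_onI[OF tensor_test_continuous_on[OF that]])

  \<comment> \<open>The quotient (1 - E \<psi>(X t))/t tends to minus the generator at
    \<open>x\<close>; the 1 leaves room for being close to the limit only eventually.\<close>
  define M where "M = \<bar>generator ?T \<psi> x\<bar> + 1"
  have tail_bound: "\<forall>\<^sub>F t in at_right 0. (1 - (\<integral>\<omega>. \<psi> (X t \<omega>) \<partial>P x)) / t \<le> M"
  proof -
    have "\<psi> x = 1" using c by (simp add: \<psi>_def)
    with generator_tendsto[OF gen[OF \<psi>_test], of x]
    have "((\<lambda>t. ((\<integral>\<omega>. \<psi> (X t \<omega>) \<partial>P x) - 1) / t) \<longlongrightarrow> generator ?T \<psi> x) (at_right 0)"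
      by (simp add: transition_semigroup_def)
    from tendstoD[OF this, of 1]
    have "\<forall>\<^sub>F t in at_right 0. dist (((\<integral>\<omega>. \<psi> (X t \<omega>) \<partial>P x) - 1) / t) (generator ?T \<psi> x) < 1" by simp
    then show ?thesis
    proof eventually_elim
      case (elim t)
      have "(1 - (\<integral>\<omega>. \<psi> (X t \<omega>) \<partial>P x)) / t = - (((\<integral>\<omega>. \<psi> (X t \<omega>) \<partial>P x) - 1) / t)"
        unfolding minus_divide_left by simp
      with elim show ?case unfolding dist_real_def M_def by linarith
    qed
  qed

  have "continuous_on UNIV (\<lambda>y. f (y - x))"
    by (rule continuous_on_compose2[OF f(1)]) (auto intro!: continuous_intros)
  moreover have "((\<lambda>y. f (y - x)) \<longlongrightarrow> 0) at_infinity"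
  proof (rule filterlim_compose[OF f(2)])
    show "filterlim (\<lambda>y. y - x) at_infinity at_infinity"
      using tendsto_add_filterlim_at_infinity'[OF filterlim_ident tendsto_const[of "- x"]] by simp
  qed
  moreover have "f (y - x) = 0" if "y \<in> ball x \<delta>" for y
    using f0[of "y - x"] that by (simp add: dist_norm norm_minus_commute)
  ultimately have F: "continuous_on UNIV (\<lambda>y. f (y - x))" "((\<lambda>y. f (y - x)) \<longlongrightarrow> 0) at_infinity"
    "\<And>y. y \<in> ball x \<delta> \<Longrightarrow> f (y - x) = 0" by blast+

  obtain B where B: "\<And>y. \<bar>f y\<bar> \<le> B" using C_zero_bounded[OF assms(6)] by blast
  show "((\<lambda>t. 1 / t * (\<integral>w. f (X t w - x) \<partial>P x)) \<longlongrightarrow> (\<integral>y. f y \<partial>\<nu> x)) (at_right 0)"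
  proof (rule tendsto_by_approximation)
    fix \<epsilon> :: real assume \<epsilon>: "0 < \<epsilon>"
    obtain w where w: "w \<in> tensor_test" and fw: "\<And>y. \<bar>f (y - x) - w y\<bar> < \<epsilon>"
      and w0: "\<And>y. norm (y - x) \<le> \<rho> \<Longrightarrow> w y = 0"
      by (rule tensor_test_approx[OF F(1,2) \<delta>, of x, OF F(3) \<epsilon>, folded \<rho>_def]) (assumption, rule that)
    obtain C where C: "\<And>y. \<bar>w y\<bar> \<le> C"
      using gen[OF w] C_zero_bounded[of w] unfolding gen_domain_def by blast
    \<comment> \<open>The decisive estimate: inside the ball both functions vanish, outside it
      \<psi> is 0 and the uniform bound applies. Integrated against the law of \<open>X t\<close>,
      it makes the error of order \<epsilon> t, so dividing by \<open>t\<close> is harmless.\<close>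
    have near: "\<bar>f (y - x) - w y\<bar> \<le> \<epsilon> * (1 - \<psi> y)" for y
    proof (cases "norm (y - x) < \<rho>")
      case True
      then have "f (y - x) = 0" "w y = 0" using f0[of "y - x"] w0[of y] \<rho> by auto
      then show ?thesis using \<epsilon> \<psi>_bounds[of y] by simp
    next
      case False
      then show ?thesis using fw[of y] \<psi>_zero[of y] by simp
    qed
    have "((\<lambda>t. (\<integral>\<omega>. w (X t \<omega>) \<partial>P x) / t) \<longlongrightarrow> (\<integral>y. w (x + y) \<partial>\<nu> x)) (at_right 0)"
      by (rule small_time_limit_tensor_test[OF assms(2-5) w \<rho>(1)])
        (auto intro!: w0 simp: dist_norm norm_minus_commute)
    moreover have "\<forall>\<^sub>F t in at_right 0.
        \<bar>1 / t * (\<integral>w. f (X t w - x) \<partial>P x) - (\<integral>\<omega>. w (X t \<omega>) \<partial>P x) / t\<bar> \<le> \<epsilon> * M"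
      using tail_bound eventually_at_right_less[of 0]
    proof eventually_elim
      case (elim t)
      have i: "integrable (P x) (\<lambda>\<omega>. f (X t \<omega> - x))" "integrable (P x) (\<lambda>\<omega>. w (X t \<omega>))"
        "integrable (P x) (\<lambda>\<omega>. \<psi> (X t \<omega>))"
        using elim B C \<psi>_bounds
        by (auto intro!: int_P[of "\<lambda>y. f (y - x)" B] int_P[of w C] int_P[of \<psi> 1] w_meas w \<psi>_test
            measurable_compose[OF _ f_meas])
      have "\<bar>(\<integral>w. f (X t w - x) \<partial>P x) - (\<integral>\<omega>. w (X t \<omega>) \<partial>P x)\<bar>
          = \<bar>\<integral>\<omega>. f (X t \<omega> - x) - w (X t \<omega>) \<partial>P x\<bar>"
        using i by simp
      also have "\<dots> \<le> (\<integral>\<omega>. \<epsilon> * (1 - \<psi> (X t \<omega>)) \<partial>P x)"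
        using i near by (intro order_trans[OF integral_abs_bound] integral_mono) auto
      also have "\<dots> = \<epsilon> * (1 - (\<integral>\<omega>. \<psi> (X t \<omega>) \<partial>P x))"
        using i by (simp add: Px.prob_space)
      finally have "\<bar>(\<integral>w. f (X t w - x) \<partial>P x) - (\<integral>\<omega>. w (X t \<omega>) \<partial>P x)\<bar> / t
          \<le> \<epsilon> * ((1 - (\<integral>\<omega>. \<psi> (X t \<omega>) \<partial>P x)) / t)"
        using elim by (simp add: divide_right_mono)
      also have "\<dots> \<le> \<epsilon> * M" using elim \<epsilon> by (intro mult_left_mono) auto
      finally show ?case using elim by (simp add: abs_divide flip: diff_divide_distrib)
    qed
    \<comment> \<open>The counterpart for the Levy measure: the error is 0 on the ball of radius
      \<rho> and below \<epsilon> outside it, where \<open>\<nu> x\<close> has finite mass.\<close>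
    moreover have "\<bar>(\<integral>y. w (x + y) \<partial>\<nu> x) - (\<integral>y. f y \<partial>\<nu> x)\<bar> \<le> \<epsilon> * (\<integral>y. ?tail y \<partial>\<nu> x)"
    proof -
      have i: "integrable (\<nu> x) (\<lambda>y. w (x + y))" "integrable (\<nu> x) f"
        using B C w0 f0 \<rho>
        by (auto intro!: int_\<nu>[of "\<lambda>y. w (x + y)" C] int_\<nu>[of f B] f_meas measurable_compose[OF _ w_meas[OF w]])
      have "\<bar>w (x + y) - f y\<bar> \<le> \<epsilon> * ?tail y" for y
        using fw[of "x + y"] w0[of "x + y"] f0[of y] \<rho> by (auto simp: indicator_def abs_minus_commute)
      then have "\<bar>\<integral>y. w (x + y) - f y \<partial>\<nu> x\<bar> \<le> (\<integral>y. \<epsilon> * ?tail y \<partial>\<nu> x)"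
        using i tail by (intro order_trans[OF integral_abs_bound] integral_mono) auto
      then show ?thesis using i by simp
    qed
    ultimately show "\<exists>h c. (h \<longlongrightarrow> c) (at_right 0) \<and>
        (\<forall>\<^sub>F t in at_right 0. \<bar>1 / t * (\<integral>w. f (X t w - x) \<partial>P x) - h t\<bar> \<le> \<epsilon> * M) \<and>
        \<bar>c - (\<integral>y. f y \<partial>\<nu> x)\<bar> \<le> \<epsilon> * (\<integral>y. ?tail y \<partial>\<nu> x)"
      by blast
  qed
qed

end
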